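(* Let $A\in\mathbb{R}^{n\times n}$ be invertible. The system $$x_{t+1}=Ax_t+\sum_{\tau=0}^D (B_\tau+\omega_t^\tau C_\tau)u_{t-\tau},\qquad t\ge 0,$$ is asymptotically mean-square stabilizable if and only if for any (symmetric) matrices $Q>0$ (of size $n\times n$) and $R>0$ (of size $m\times m$) there exists a unique positive definite solution $Z>0$ of the nonlinear delay-dependent algebraic Riccati equation $$-Z+A'ZA+Q-A'ZL\Psi^{-1}L'ZA=0,$$ where $$\Psi=L'ZL+\sum_{\tau=0}^D\sigma_\tau^2C_\tau'(A')^DZA^DC_\tau+U_{R,Q},\qquad L=\sum_{j=0}^DA^{D-j}B_j,$$ $$U_{R,Q}=R+\sum_{\tau=1}^D\sum_{h=1}^\tau\sigma_\tau^2C_\tau'(A')^{D-h}QA^{D-h}C_\tau.$$ Moreover, in this case a stabilizing control policy is given by $$u_t^*=-\Psi^{-1}L'ZA^D\Big(Ax_t+\sum_{\tau=1}^D\sum_{j=\tau}^DA^{\tau-j}B_ju^*_{t-\tau}\Big).$$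
   Context: Primes denote transposes and $\mathbf{E}$ denotes expectation; $Z>0$ means $Z$ is symmetric positive definite. $D\ge 0$ is an integer (empty sums are zero), $x_t\in\mathbb{R}^n$ is the state, $u_t\in\mathbb{R}^m$ is the control input, and $A\in\mathbb{R}^{n\times n}$, $B_\tau,C_\tau\in\mathbb{R}^{n\times m}$ ($\tau=0,\dots,D$) are constant. The initial data $x_0$ and $u_t$, $t=-D,\dots,-1$, are given a priori (deterministic). Noise: $\{\omega_t^\tau\}_{t\ge0}$, $\tau=0,\dots,D$, are real random sequences, independent and identically distributed in time for each $\tau$ and mutually independent for different $\tau$, with $\mathbf{E}(\omega_t^\tau)=0$ and $\mathbf{E}(\omega_t^\tau\omega_s^\tau)=\sigma_\tau^2\delta_{ts}$ ($\delta_{ts}$ the Kronecker delta). Put $\omega_t=(\omega_t^0,\dots,\omega_t^D)'$ and $\mathcal{F}_t=\sigma\{\omega_s: 0\le s\le t\}$. Admissible controls: $\mathcal{U}_{ad}$ is the set of control processes $u$ such that $u_t$ is $\mathcal{F}_t$-measurable, $\sum_{t=0}^\infty\mathbf{E}(u_t'u_t)<\infty$, and $u_t=K_0x_t+\sum_{\tau=1}^DK_\tau u_{t-\tau}$ for all $t\ge 0$, for some constant matrices $K_0,\dots,K_D$ of compatible dimensions. (Such $u_t$ is then in fact $\mathcal{F}_{t-1}$-measurable.) Stabilizability: the system is asymptotically mean-square stabilizable if there exists a feedback control law (constant gains $K_0,\dots,K_D$) in $\mathcal{U}_{ad}$ such that the closed-loop system satisfies $\lim_{t\to\infty}\mathbf{E}(x_t'x_t)=0$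 for any initial values $x_0$ and $u_t$, $t=-D,\dots,-1$. A control policy achieving this is called stabilizing. *)

theory Defs
  imports "HOL-Probability.Probability"
begin

definition pos_def :: "real^'k^'k \<Rightarrow> bool" where
  "pos_def Z \<longleftrightarrow> transpose Z = Z \<and> (\<forall>v. v \<noteq> 0 \<longrightarrow> v \<bullet> (Z *v v) > 0)"

text \<open>Multiplication \<open>*\<close> on type \<open>vec\<close> is componentwise, so powers with respect to the
  matrix product \<open>**\<close> have to be introduced.\<close>

primrec mat_pow :: "real^'k^'k \<Rightarrow> nat \<Rightarrow> real^'k^'k" where
  "mat_pow A 0 = mat 1"
| "mat_pow A (Suc k) = A ** mat_pow A k"

definition mat_powi :: "real^'k^'k \<Rightarrow> int \<Rightarrow> real^'k^'k" where
  "mat_powi A k = (if 0 \<le> k then mat_pow A (nat k) else mat_pow (matrix_inv A) (nat (- k)))"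


section \<open>The Riccati equation\<close>

definition L_mat :: "nat \<Rightarrow> real^'n^'n \<Rightarrow> (nat \<Rightarrow> real^'m^'n) \<Rightarrow> real^'m^'n" where
  "L_mat D A B = (\<Sum>j=0..D. mat_pow A (D - j) ** B j)"

definition U_mat :: "nat \<Rightarrow> real^'n^'n \<Rightarrow> (nat \<Rightarrow> real^'m^'n) \<Rightarrow> (nat \<Rightarrow> real)
    \<Rightarrow> real^'m^'m \<Rightarrow> real^'n^'n \<Rightarrow> real^'m^'m" where
  "U_mat D A C \<sigma> R Q = R + (\<Sum>\<tau>=1..D. \<Sum>h=1..\<tau>. (\<sigma> \<tau>)\<^sup>2 *\<^sub>R
      (transpose (C \<tau>) ** mat_pow (transpose A) (D - h) ** Q ** mat_pow A (D - h) ** C \<tau>))"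

definition Psi_mat :: "nat \<Rightarrow> real^'n^'n \<Rightarrow> (nat \<Rightarrow> real^'m^'n) \<Rightarrow> (nat \<Rightarrow> real^'m^'n)
    \<Rightarrow> (nat \<Rightarrow> real) \<Rightarrow> real^'m^'m \<Rightarrow> real^'n^'n \<Rightarrow> real^'n^'n \<Rightarrow> real^'m^'m" where
  "Psi_mat D A B C \<sigma> R Q Z =
     transpose (L_mat D A B) ** Z ** L_mat D A B
     + (\<Sum>\<tau>=0..D. (\<sigma> \<tau>)\<^sup>2 *\<^sub>R
         (transpose (C \<tau>) ** mat_pow (transpose A) D ** Z ** mat_pow A D ** C \<tau>))
     + U_mat D A C \<sigma> R Q"

definition solves_riccati :: "nat \<Rightarrow> real^'n^'n \<Rightarrow> (nat \<Rightarrow> real^'m^'n) \<Rightarrow> (nat \<Rightarrow> real^'m^'n)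
    \<Rightarrow> (nat \<Rightarrow> real) \<Rightarrow> real^'m^'m \<Rightarrow> real^'n^'n \<Rightarrow> real^'n^'n \<Rightarrow> bool" where
  "solves_riccati D A B C \<sigma> R Q Z \<longleftrightarrow>
     - Z + transpose A ** Z ** A + Q
     - transpose A ** Z ** L_mat D A B ** matrix_inv (Psi_mat D A B C \<sigma> R Q Z)
         ** transpose (L_mat D A B) ** Z ** A = 0"


section \<open>The noise\<close>

text \<open>\<open>\<omega> \<tau> t\<close> is the noise at time \<open>t\<close> in channel \<open>\<tau> \<le> D\<close>. The last independence condition
  is between whole sequences, regarded as random elements of the product space. Square
  integrability is demanded explicitly because the integral of a non-integrable function
  is \<open>0\<close>.\<close>

definition noise :: "'w measure \<Rightarrow> nat \<Rightarrow> (nat \<Rightarrow> real) \<Rightarrow> (nat \<Rightarrow> nat \<Rightarrow> 'w \<Rightarrow> real) \<Rightarrow> bool" where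
  "noise M D \<sigma> \<omega> \<longleftrightarrow>
     prob_space M \<and>
     (\<forall>\<tau>\<le>D. prob_space.indep_vars M (\<lambda>_. borel) (\<omega> \<tau>) UNIV) \<and>
     (\<forall>\<tau>\<le>D. \<forall>s t. distr M borel (\<omega> \<tau> s) = distr M borel (\<omega> \<tau> t)) \<and>
     prob_space.indep_vars M (\<lambda>_. PiM UNIV (\<lambda>_::nat. borel)) (\<lambda>\<tau> p t. \<omega> \<tau> t p) {..D} \<and>
     (\<forall>\<tau>\<le>D. \<forall>t. integrable M (\<lambda>p. (\<omega> \<tau> t p)\<^sup>2)) \<and>
     (\<forall>\<tau>\<le>D. \<forall>t. (LINT p|M. \<omega> \<tau> t p) = 0) \<and>
     (\<forall>\<tau>\<le>D. \<forall>t s. (LINT p|M. \<omega> \<tau> t p * \<omega> \<tau> s p) = (\<sigma> \<tau>)\<^sup>2 * of_bool (t = s))"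

definition noise_filtration ::
    "'w measure \<Rightarrow> nat \<Rightarrow> (nat \<Rightarrow> nat \<Rightarrow> 'w \<Rightarrow> real) \<Rightarrow> nat \<Rightarrow> 'w measure" where
  "noise_filtration M D \<omega> t =
     sigma (space M) (\<Union>s\<in>{..t}. \<Union>\<tau>\<in>{..D}. {\<omega> \<tau> s -` S \<inter> space M | S. S \<in> sets borel})"


section \<open>The controlled system\<close>

text \<open>The initial controls are \<open>\<phi> s\<close> for \<open>s = -D, \<dots>, -1\<close>, so controls are indexed by integers.\<close>

definition system_trajectory :: "'w measure \<Rightarrow> nat \<Rightarrow> real^'n^'n \<Rightarrow> (nat \<Rightarrow> real^'m^'n)
    \<Rightarrow> (nat \<Rightarrow> real^'m^'n) \<Rightarrow> (nat \<Rightarrow> nat \<Rightarrow> 'w \<Rightarrow> real) \<Rightarrow> real^'n \<Rightarrow> (int \<Rightarrow> real^'m)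
    \<Rightarrow> (nat \<Rightarrow> 'w \<Rightarrow> real^'n) \<Rightarrow> (int \<Rightarrow> 'w \<Rightarrow> real^'m) \<Rightarrow> bool" where
  "system_trajectory M D A B C \<omega> x0 \<phi> x u \<longleftrightarrow> (\<forall>p\<in>space M.
     x 0 p = x0 \<and>
     (\<forall>s\<in>{- int D..-1}. u s p = \<phi> s) \<and>
     (\<forall>t. x (Suc t) p = A *v x t p
        + (\<Sum>\<tau>=0..D. (B \<tau> + \<omega> \<tau> t p *\<^sub>R C \<tau>) *v u (int t - int \<tau>) p)))"

text \<open>A policy computes the control \<open>u t\<close> from \<open>x t\<close> and the past controls \<open>\<lambda>\<tau>. u (t - \<tau>)\<close>.\<close>

type_synonym ('n, 'm) policy = "real^'n \<Rightarrow> (nat \<Rightarrow> real^'m) \<Rightarrow> real^'m"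

definition gain_policy :: "nat \<Rightarrow> real^'n^'m \<Rightarrow> (nat \<Rightarrow> real^'m^'m) \<Rightarrow> ('n::finite, 'm::finite) policy"
  where "gain_policy D K\<^sub>0 K y v = K\<^sub>0 *v y + (\<Sum>\<tau>=1..D. K \<tau> *v v \<tau>)"

definition follows_policy :: "'w measure \<Rightarrow> ('n::finite, 'm::finite) policy
    \<Rightarrow> (nat \<Rightarrow> 'w \<Rightarrow> real^'n) \<Rightarrow> (int \<Rightarrow> 'w \<Rightarrow> real^'m) \<Rightarrow> bool" where
  "follows_policy M \<pi> x u \<longleftrightarrow>
     (\<forall>p\<in>space M. \<forall>t. u (int t) p = \<pi> (x t p) (\<lambda>\<tau>. u (int t - int \<tau>) p))"

definition admissible_controls :: "'w measure \<Rightarrow> nat \<Rightarrow> real^'n^'n \<Rightarrow> (nat \<Rightarrow> real^'m^'n)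
    \<Rightarrow> (nat \<Rightarrow> real^'m^'n) \<Rightarrow> (nat \<Rightarrow> nat \<Rightarrow> 'w \<Rightarrow> real) \<Rightarrow> real^'n \<Rightarrow> (int \<Rightarrow> real^'m)
    \<Rightarrow> (int \<Rightarrow> 'w \<Rightarrow> real^'m) set" where
  "admissible_controls M D A B C \<omega> x0 \<phi> =
     {u. (\<forall>t. u (int t) \<in> borel_measurable (noise_filtration M D \<omega> t)) \<and>
         (\<forall>t. integrable M (\<lambda>p. u (int t) p \<bullet> u (int t) p)) \<and>
         summable (\<lambda>t. LINT p|M. u (int t) p \<bullet> u (int t) p) \<and>
         (\<exists>x K\<^sub>0 K. system_trajectory M D A B C \<omega> x0 \<phi> x u \<and>
            follows_policy M (gain_policy D K\<^sub>0 K) x u)}"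

text \<open>For given initial data a policy determines the trajectory, see
  \<open>closed_loop_exists\<close> and \<open>closed_loop_unique\<close> below; the quantification over \<open>x\<close> and \<open>u\<close> is
  therefore neither vacuous nor a choice.\<close>

definition stabilizing_policy :: "'w measure \<Rightarrow> nat \<Rightarrow> real^'n^'n \<Rightarrow> (nat \<Rightarrow> real^'m^'n)
    \<Rightarrow> (nat \<Rightarrow> real^'m^'n) \<Rightarrow> (nat \<Rightarrow> nat \<Rightarrow> 'w \<Rightarrow> real) \<Rightarrow> ('n::finite, 'm::finite) policy \<Rightarrow> bool"
  where
  "stabilizing_policy M D A B C \<omega> \<pi> \<longleftrightarrow>
     (\<forall>x0 \<phi> x u. system_trajectory M D A B C \<omega> x0 \<phi> x u \<longrightarrow> follows_policy M \<pi> x u \<longrightarrow>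
        u \<in> admissible_controls M D A B C \<omega> x0 \<phi> \<and>
        (\<forall>t. integrable M (\<lambda>p. x t p \<bullet> x t p)) \<and>
        (\<lambda>t. LINT p|M. x t p \<bullet> x t p) \<longlonglongrightarrow> 0)"

definition ms_stabilizable :: "'w measure \<Rightarrow> nat \<Rightarrow> real^'n^'n \<Rightarrow> (nat \<Rightarrow> real^'m^'n)
    \<Rightarrow> (nat \<Rightarrow> real^'m^'n) \<Rightarrow> (nat \<Rightarrow> nat \<Rightarrow> 'w \<Rightarrow> real) \<Rightarrow> bool" where
  "ms_stabilizable M D A B C \<omega> \<longleftrightarrow>
     (\<exists>K\<^sub>0 K. stabilizing_policy M D A B C \<omega> (gain_policy D K\<^sub>0 K))"

definition riccati_policy :: "nat \<Rightarrow> real^'n^'n \<Rightarrow> (nat \<Rightarrow> real^'m^'n) \<Rightarrow> (nat \<Rightarrow> real^'m^'n)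
    \<Rightarrow> (nat \<Rightarrow> real) \<Rightarrow> real^'m^'m \<Rightarrow> real^'n^'n \<Rightarrow> real^'n^'n \<Rightarrow> ('n::finite, 'm::finite) policy"
  where
  "riccati_policy D A B C \<sigma> R Q Z y v =
     - ((matrix_inv (Psi_mat D A B C \<sigma> R Q Z) ** transpose (L_mat D A B) ** Z ** mat_pow A D)
        *v (A *v y + (\<Sum>\<tau>=1..D. \<Sum>j=\<tau>..D. (mat_powi A (int \<tau> - int j) ** B j) *v v \<tau>)))"


section \<open>Well-posedness of the closed loop\<close>

lemma closed_loop_exists:
  fixes \<pi> :: "('n::finite, 'm::finite) policy"
  assumes past: "\<And>y v v'. (\<And>\<tau>. 1 \<le> \<tau> \<Longrightarrow> \<tau> \<le> D \<Longrightarrow> v \<tau> = v' \<tau>) \<Longrightarrow> \<pi> y v = \<pi> y v'"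
  shows "\<exists>x u. system_trajectory M D A B C \<omega> x0 \<phi> x u \<and> follows_policy M \<pi> x u"
proof -
  define nxt where "nxt p t s = (let h = (snd s)(int t := \<pi> (fst s) (\<lambda>\<tau>. snd s (int t - int \<tau>)))
     in (A *v fst s + (\<Sum>\<tau>=0..D. (B \<tau> + \<omega> \<tau> t p *\<^sub>R C \<tau>) *v h (int t - int \<tau>)), h))"
    for p t and s :: "(real^'n) \<times> (int \<Rightarrow> real^'m)"
  define st where "st p = rec_nat (x0, \<phi>) (nxt p)" for p
  have st0: "st p 0 = (x0, \<phi>)" and stS: "st p (Suc t) = nxt p t (st p t)" for p t
    by (simp_all add: st_def)
  define x where "x t p = fst (st p t)" for t p
  define u where "u s p = snd (st p (nat (s + 1))) s" for s p
  have step: "snd (st p (Suc t)) s = snd (st p t) s" if "s \<noteq> int t" for p t s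
    using that by (simp add: stS nxt_def Let_def)
  have keep: "snd (st p (Suc t + d)) s = snd (st p (Suc t)) s" if "s \<le> int t" for p t s d
    by (induction d) (use that step in auto)
  have hist: "snd (st p (Suc t)) s = u s p" if "s \<le> int t" for p t s
  proof (cases "s < 0")
    case True
    have "snd (st p k) s = \<phi> s" for k
      by (induction k) (use True step st0 in auto)
    then show ?thesis by (simp add: u_def)
  next
    case False
    define k where "k = nat s"
    define d where "d = t - k"
    have "s = int k" "t = k + d"
      using False that by (auto simp: k_def d_def)
    then show ?thesis
      using keep[of s k p d] by (simp add: u_def nat_add_distrib)
  qed
  have pol: "u (int t) p = \<pi> (x t p) (\<lambda>\<tau>. u (int t - int \<tau>) p)" for t p
  proof -
    have "u (int t) p = \<pi> (x t p) (\<lambda>\<tau>. snd (st p t) (int t - int \<tau>))"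
      using hist[of "int t" t p] by (simp add: stS nxt_def Let_def x_def)
    also have "\<dots> = \<pi> (x t p) (\<lambda>\<tau>. u (int t - int \<tau>) p)"
    proof (rule past)
      fix \<tau> :: nat assume "1 \<le> \<tau>"
      then show "snd (st p t) (int t - int \<tau>) = u (int t - int \<tau>) p"
        using hist[of "int t - int \<tau>" t p] step[of "int t - int \<tau>" t p] by simp
    qed
    finally show ?thesis .
  qed
  have dyn: "x (Suc t) p = A *v x t p
      + (\<Sum>\<tau>=0..D. (B \<tau> + \<omega> \<tau> t p *\<^sub>R C \<tau>) *v u (int t - int \<tau>) p)" for t p
  proof -
    have "x (Suc t) p = A *v x t p
      + (\<Sum>\<tau>=0..D. (B \<tau> + \<omega> \<tau> t p *\<^sub>R C \<tau>) *v snd (st p (Suc t)) (int t - int \<tau>))"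
      by (simp add: x_def stS nxt_def Let_def)
    then show ?thesis by (simp add: hist)
  qed
  have init: "u s p = \<phi> s" if "s \<in> {- int D..-1}" for s p
    using that by (simp add: u_def st0)
  have "x 0 p = x0" for p by (simp add: x_def st0)
  with pol dyn init show ?thesis
    unfolding system_trajectory_def follows_policy_def by blast
qed

lemma closed_loop_unique:
  fixes \<pi> :: "('n::finite, 'm::finite) policy"
  assumes past: "\<And>y v v'. (\<And>\<tau>. 1 \<le> \<tau> \<Longrightarrow> \<tau> \<le> D \<Longrightarrow> v \<tau> = v' \<tau>) \<Longrightarrow> \<pi> y v = \<pi> y v'"
    and "system_trajectory M D A B C \<omega> x0 \<phi> x u" "follows_policy M \<pi> x u"
    and "system_trajectory M D A B C \<omega> x0 \<phi> x' u'" "follows_policy M \<pi> x' u'"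
    and p: "p \<in> space M"
  shows "x t p = x' t p" and "u (int t) p = u' (int t) p"
proof -
  have pol: "u (int t) p = \<pi> (x t p) (\<lambda>\<tau>. u (int t - int \<tau>) p)"
      "u' (int t) p = \<pi> (x' t p) (\<lambda>\<tau>. u' (int t - int \<tau>) p)" for t
    using assms(2-) unfolding follows_policy_def by auto
  have dyn: "x (Suc t) p = A *v x t p
      + (\<Sum>\<tau>=0..D. (B \<tau> + \<omega> \<tau> t p *\<^sub>R C \<tau>) *v u (int t - int \<tau>) p)"
      "x' (Suc t) p = A *v x' t p
      + (\<Sum>\<tau>=0..D. (B \<tau> + \<omega> \<tau> t p *\<^sub>R C \<tau>) *v u' (int t - int \<tau>) p)" for t
    using assms(2-) unfolding system_trajectory_def by auto
  have *: "x t p = x' t p \<and> (\<forall>s. - int D \<le> s \<and> s < int t \<longrightarrow> u s p = u' s p)" for t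
  proof (induction t)
    case 0
    then show ?case using assms(2-) unfolding system_trajectory_def by auto
  next
    case (Suc t)
    have "u (int t) p = u' (int t) p"
    proof -
      have "\<pi> (x t p) (\<lambda>\<tau>. u (int t - int \<tau>) p) = \<pi> (x t p) (\<lambda>\<tau>. u' (int t - int \<tau>) p)"
        by (rule past) (use Suc in simp)
      with Suc show ?thesis by (simp only: pol)
    qed
    with Suc have u: "u s p = u' s p" if "- int D \<le> s" "s \<le> int t" for s
      using that by (cases "s = int t") auto
    then have "x (Suc t) p = x' (Suc t) p"
      unfolding dyn using Suc by (auto intro!: sum.cong)
    with u show ?case by auto
  qed
  show "x t p = x' t p" "u (int t) p = u' (int t) p"
    using *[of t] *[of "Suc t"] by auto
qed

end

theory Submission
  imports Defs
begin

text \<open>The delays of the deterministic inputs are removed by the predictor: \<open>y\<^sub>t\<close> is the state that the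
  noise-free system would reach at time \<open>t + D\<close> if no control were applied from time \<open>t\<close> on. It satisfies
  \<open>y\<^sub>t\<^sub>+\<^sub>1 = A y\<^sub>t + L u\<^sub>t + (\<Sum>\<tau>. \<omega>\<^sub>t\<^sup>\<tau> A\<^sup>D C\<^sub>\<tau> u\<^sub>t\<^sub>-\<^sub>\<tau>)\<close> (\<open>predictor_Suc\<close>), so only the noise still acts
  on delayed controls. The noise at time \<open>t\<close> is centred and independent of everything before \<open>t\<close>, hence
  in \<open>E (y\<^sub>t\<^sub>+\<^sub>1' Z y\<^sub>t\<^sub>+\<^sub>1)\<close> the cross terms vanish and channel \<open>\<tau>\<close> adds \<open>\<sigma>\<^sub>\<tau>\<^sup>2\<close> times a quadratic form in
  \<open>u\<^sub>t\<^sub>-\<^sub>\<tau>\<close> (\<open>expectation_noisy_quadratic\<close>). If these contributions are booked when the control is applied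
  and not when the noise hits it, that is, if \<open>E (y\<^sub>t' Z y\<^sub>t)\<close> is increased by all contributions that past
  controls will still make, the resulting energy changes in one step as if the noise were undelayed.
  Completing the square in \<open>u\<^sub>t\<close> then gives (\<open>energy_step_riccati\<close>)

  \<open>energy Z (t + 1) - energy Z t = E (y\<^sub>t' (F Z - Z) y\<^sub>t) + E ((u\<^sub>t + K y\<^sub>t)' \<Psi> (u\<^sub>t + K y\<^sub>t)) - E (y\<^sub>t' Q y\<^sub>t + u\<^sub>t' U u\<^sub>t)\<close>

  where \<open>F\<close> is the map whose fixed points are the solutions of the Riccati equation and \<open>K = \<Psi>\<inverse> L' Z A\<close>.
  Everything follows from this identity.

  A solution \<open>Z\<close> stabilizes: the Riccati policy is \<open>u\<^sub>t = - K y\<^sub>t\<close>, so the energy decreases by the running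
  cost, the costs are summable, and \<open>y\<^sub>t\<close> and \<open>u\<^sub>t\<close>, therefore also \<open>x\<^sub>t\<close>, tend to zero in mean
  square (\<open>optimal_ms_null\<close>).

  Solutions are unique: along the optimal loop of \<open>Z\<close> the total cost is at most the initial energy
  \<open>v' Z v\<close>, whereas for any other solution \<open>Y\<close> it is at least \<open>v' Y v\<close>, because the \<open>Y\<close>-energy tends to
  zero; so \<open>v' Y v \<le> v' Z v\<close>, and by symmetry equality holds (\<open>riccati_solution_le\<close>).

  Solutions exist under stabilizability: value iteration \<open>Z\<^sub>k\<^sub>+\<^sub>1 = F Z\<^sub>k\<close> from \<open>Z\<^sub>0 = 0\<close> increases, so it
  converges as soon as the traces are bounded (\<open>riccati_fixed_point\<close>). Each iterate is a subsolution,
  \<open>Z \<le> F Z\<close>, for which the identity bounds the initial energy by the cost up to time \<open>T\<close> plus the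
  energy at \<open>T\<close>. Along a stabilizing loop the latter is a small multiple of the trace of \<open>Z\<close> once \<open>T\<close>
  is large; starting such loops from each basis vector and adding up bounds the trace by half of itself
  plus a constant (\<open>stabilizing_trace_bound\<close>).\<close>

section \<open>Symmetric matrices as quadratic forms\<close>

definition psd :: "real^'k^'k \<Rightarrow> bool" where
  "psd Z \<longleftrightarrow> transpose Z = Z \<and> (\<forall>v. 0 \<le> v \<bullet> (Z *v v))"

lemma psd_0 [simp]: "psd 0"
  by (simp add: psd_def transpose_def vec_eq_iff)

lemma psd_sym: "psd Z \<Longrightarrow> transpose Z = Z"
  by (simp add: psd_def)

lemma psd_nonneg: "psd Z \<Longrightarrow> 0 \<le> v \<bullet> (Z *v v)"
  by (simp add: psd_def)

lemma pos_def_imp_psd: "pos_def Z \<Longrightarrow> psd Z"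
  unfolding pos_def_def psd_def by (metis inner_zero_left less_eq_real_def)

lemma inner_matrix_vector_left: "(A *v v) \<bullet> w = v \<bullet> (transpose A *v w)" for A :: "real^'a^'b"
  by (metis dot_lmul_matrix transpose_matrix_vector transpose_transpose)

lemma inner_symmetric_commute:
  fixes Z :: "real^'k^'k"
  assumes "transpose Z = Z"
  shows "v \<bullet> (Z *v w) = w \<bullet> (Z *v v)"
  using inner_matrix_vector_left[of Z v w] assms by (metis inner_commute)

lemma inner_congruence:
  fixes X :: "real^'a^'c" and Y :: "real^'b^'d" and Z :: "real^'d^'c"
  shows "v \<bullet> ((transpose X ** Z ** Y) *v w) = (X *v v) \<bullet> (Z *v (Y *v w))"
  by (simp add: inner_matrix_vector_left matrix_vector_mul_assoc matrix_mul_assoc)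

lemma transpose_add: "transpose (A + B) = transpose A + transpose B" for A B :: "real^'a^'b"
  by (simp add: transpose_def vec_eq_iff)

lemma transpose_diff: "transpose (A - B) = transpose A - transpose B" for A B :: "real^'a^'b"
  by (simp add: transpose_def vec_eq_iff)

lemma transpose_congruence:
  fixes X :: "real^'a^'c"
  assumes "transpose Z = Z"
  shows "transpose (transpose X ** Z ** X) = transpose X ** Z ** X"
  by (simp add: matrix_transpose_mul assms matrix_mul_assoc)

lemma sum_matrix_vector_mult: "(\<Sum>i\<in>I. f i) *v v = (\<Sum>i\<in>I. f i *v v)"
  for f :: "'i \<Rightarrow> real^'a^'b"
  by (induction I rule: infinite_finite_induct) (auto simp: matrix_vector_mult_add_rdistrib)

lemma matrix_vector_mult_sum: "A *v (\<Sum>i\<in>I. f i) = (\<Sum>i\<in>I. A *v f i)"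
  for A :: "real^'a^'b"
  by (rule linear_sum) simp

text \<open>Polarization: the values of a symmetric form on the diagonal determine the form.\<close>
lemma symmetric_eqI:
  fixes Y Z :: "real^'k^'k"
  assumes "transpose Y = Y" "transpose Z = Z" and eq: "\<And>v. v \<bullet> (Y *v v) = v \<bullet> (Z *v v)"
  shows "Y = Z"
proof -
  have "v \<bullet> (Y *v w) = v \<bullet> (Z *v w)" for v w
    using eq[of "v + w"] eq[of v] eq[of w]
      inner_symmetric_commute[OF assms(1), of v w] inner_symmetric_commute[OF assms(2), of v w]
    by (simp add: matrix_vector_right_distrib inner_left_distrib inner_right_distrib)
  then show ?thesis
    by (metis matrix_eq vector_eq_rdot inner_commute)
qed

text \<open>The form attains a positive minimum on the compact unit sphere; homogeneity does the rest.\<close>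
lemma pos_def_coercive:
  fixes U :: "real^'k^'k"
  assumes "pos_def U"
  obtains c where "c > 0" "\<And>v. c * (v \<bullet> v) \<le> v \<bullet> (U *v v)"
proof -
  have "\<exists>w\<in>sphere 0 1. \<forall>v\<in>sphere 0 1. w \<bullet> (U *v w) \<le> v \<bullet> (U *v v)"
    by (rule continuous_attains_inf) (auto intro!: continuous_on_inner continuous_on_id
        linear_continuous_on[OF matrix_vector_mul_bounded_linear])
  then obtain w :: "real^'k" where w: "norm w = 1"
    and min: "\<And>v. norm v = 1 \<Longrightarrow> w \<bullet> (U *v w) \<le> v \<bullet> (U *v v)"
    by auto
  have "w \<bullet> (U *v w) > 0"
    using assms w unfolding pos_def_def by (metis norm_zero zero_neq_one)
  moreover have "w \<bullet> (U *v w) * (v \<bullet> v) \<le> v \<bullet> (U *v v)" for v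
  proof (cases "v = 0")
    case False
    define e where "e = (1 / norm v) *\<^sub>R v"
    have e: "norm e = 1" and v: "v = norm v *\<^sub>R e"
      using False by (auto simp: e_def)
    have "v \<bullet> v = (norm v)\<^sup>2" and "v \<bullet> (U *v v) = (norm v)\<^sup>2 * (e \<bullet> (U *v e))"
      by (simp add: power2_norm_eq_inner) 
        (subst (1 2) v, simp add: matrix_vector_mult_scaleR power2_eq_square)
    then show ?thesis
      using mult_left_mono[OF min[OF e], of "(norm v)\<^sup>2"] by (simp add: mult.commute)
  qed simp
  ultimately show ?thesis using that by blast
qed

lemma pos_def_imp_invertible:
  fixes U :: "real^'k^'k"
  assumes "pos_def U"
  shows "invertible U"
  unfolding invertible_left_inverse matrix_left_invertible_ker
  using assms unfolding pos_def_def by (metis inner_zero_right less_irrefl)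

lemma
  fixes A :: "real^'k^'k"
  assumes "invertible A"
  shows matrix_inv_right: "A ** matrix_inv A = mat 1"
    and matrix_inv_left: "matrix_inv A ** A = mat 1"
  using someI_ex[OF assms[unfolded invertible_def]] by (simp_all add: matrix_inv_def)

lemma matrix_inv_mult_vector:
  fixes A :: "real^'k^'k"
  assumes "invertible A"
  shows "A *v (matrix_inv A *v v) = v" "matrix_inv A *v (A *v v) = v"
  using matrix_inv_left[OF assms] matrix_inv_right[OF assms] by (simp_all add: matrix_vector_mul_assoc)

lemma transpose_matrix_inv_symmetric:
  fixes A :: "real^'k^'k"
  assumes "invertible A" "transpose A = A"
  shows "transpose (matrix_inv A) = matrix_inv A"
proof -
  have "transpose (matrix_inv A) ** A = mat 1"
    by (metis assms matrix_inv_right matrix_transpose_mul transpose_mat)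
  then show ?thesis
    by (metis assms(1) matrix_inv_right matrix_mul_assoc matrix_mul_lid matrix_mul_rid)
qed

text \<open>Testing the form on \<open>e\<^sub>i \<plusminus> e\<^sub>j\<close> bounds every entry by the trace. The constant is crude, but it is
  the linear dependence on the trace that makes an absorption argument for the trace possible.\<close>
lemma psd_quad_le_trace:
  fixes Z :: "real^'k^'k"
  assumes Z: "psd Z"
  shows "v \<bullet> (Z *v v) \<le> real CARD('k)^2 * trace Z * (v \<bullet> v)"
proof -
  have entry: "Z $ i $ j = axis i 1 \<bullet> (Z *v axis j 1)" for i j
    by (simp add: inner_axis' matrix_vector_mult_basis column_def)
  have diag: "0 \<le> Z $ i $ i" for i
    using psd_nonneg[OF Z] by (simp add: entry)
  then have diag_le: "Z $ i $ i \<le> trace Z" for i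
    unfolding trace_def by (intro member_le_sum) auto
  have abs_le: "\<bar>Z $ i $ j\<bar> \<le> trace Z" for i j
  proof -
    have "0 \<le> (axis i 1 + s *\<^sub>R axis j 1) \<bullet> (Z *v (axis i 1 + s *\<^sub>R axis j 1))" for s :: real
      using Z by (rule psd_nonneg)
    also have "\<dots> s = Z $ i $ i + s * (2 * Z $ i $ j) + s * s * Z $ j $ j" for s
      using inner_symmetric_commute[OF psd_sym[OF Z], of "axis i 1" "axis j 1"]
      by (simp add: matrix_vector_right_distrib matrix_vector_mult_scaleR inner_left_distrib
          inner_right_distrib entry algebra_simps)
    finally have *: "0 \<le> Z $ i $ i + s * (2 * Z $ i $ j) + s * s * Z $ j $ j" for s .
    from *[of 1] *[of "-1"] diag_le[of i] diag_le[of j] show ?thesis by simp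
  qed
  have comp: "\<bar>v $ i\<bar> * \<bar>v $ j\<bar> \<le> v \<bullet> v" for i j
    by (metis component_le_norm_cart mult_mono norm_ge_zero abs_ge_zero power2_eq_square power2_norm_eq_inner)
  have "v \<bullet> (Z *v v) = (\<Sum>i\<in>UNIV. \<Sum>j\<in>UNIV. Z $ i $ j * (v $ i * v $ j))"
    by (simp add: inner_vec_def matrix_vector_mult_def sum_distrib_left algebra_simps)
  also have "\<dots> \<le> (\<Sum>i\<in>(UNIV::'k set). \<Sum>j\<in>(UNIV::'k set). trace Z * (v \<bullet> v))"
  proof (intro sum_mono)
    fix i j
    have "Z $ i $ j * (v $ i * v $ j) \<le> \<bar>Z $ i $ j\<bar> * (\<bar>v $ i\<bar> * \<bar>v $ j\<bar>)"
      by (metis abs_ge_self abs_mult)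
    also have "\<dots> \<le> trace Z * (v \<bullet> v)"
      using abs_le comp by (intro mult_mono) (auto intro: order_trans[OF abs_ge_zero])
    finally show "Z $ i $ j * (v $ i * v $ j) \<le> trace Z * (v \<bullet> v)" .
  qed
  also have "\<dots> = real CARD('k)^2 * trace Z * (v \<bullet> v)"
    by (simp add: power2_eq_square)
  finally show ?thesis .
qed

lemma psd_trace_nonneg: "psd Z \<Longrightarrow> 0 \<le> trace Z"
  unfolding trace_def using psd_nonneg[of Z "axis _ 1"]
  by (intro sum_nonneg) (simp add: inner_axis' matrix_vector_mult_basis column_def)

lemma psd_add: "psd X \<Longrightarrow> psd Y \<Longrightarrow> psd (X + Y)"
  by (simp add: psd_def transpose_add matrix_vector_mult_add_rdistrib inner_right_distrib)

lemma psd_sum: "(\<And>i. i \<in> I \<Longrightarrow> psd (f i)) \<Longrightarrow> psd (\<Sum>i\<in>I. f i)"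
  by (induction I rule: infinite_finite_induct) (auto intro: psd_add)

lemma psd_scaleR: "psd X \<Longrightarrow> 0 \<le> c \<Longrightarrow> psd (c *\<^sub>R X)"
  by (simp add: psd_def transpose_scalar flip: scaleR_matrix_vector_assoc)

lemma psd_congruence: "psd Z \<Longrightarrow> psd (transpose X ** Z ** X)"
  unfolding psd_def by (simp add: transpose_congruence inner_congruence del: transpose_matrix_vector)

lemma pos_def_add_psd: "pos_def X \<Longrightarrow> psd Y \<Longrightarrow> pos_def (X + Y)"
  by (simp add: pos_def_def psd_def transpose_add matrix_vector_mult_add_rdistrib inner_right_distrib
      add_pos_nonneg)

lemma pos_def_mat_1: "pos_def (mat 1)"
  by (simp add: pos_def_def)

lemma tendsto_matrix_vector_mult:
  fixes Z :: "'x \<Rightarrow> real^'a^'b"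
  assumes "(Z \<longlongrightarrow> Z0) F" "(v \<longlongrightarrow> v0) F"
  shows "((\<lambda>k. Z k *v v k) \<longlongrightarrow> Z0 *v v0) F"
  unfolding matrix_vector_mult_def
  by (intro vec_tendstoI) (simp, intro tendsto_sum tendsto_mult tendsto_vec_nth assms)

lemma tendsto_matrix_mult:
  fixes X :: "'x \<Rightarrow> real^'a^'b" and Y :: "'x \<Rightarrow> real^'c^'a"
  assumes "(X \<longlongrightarrow> X0) F" "(Y \<longlongrightarrow> Y0) F"
  shows "((\<lambda>k. X k ** Y k) \<longlongrightarrow> X0 ** Y0) F"
  unfolding matrix_matrix_mult_def
  by (intro vec_tendstoI) (simp, intro tendsto_sum tendsto_mult tendsto_vec_nth assms)

text \<open>Monotone convergence for forms: the values on each vector converge, and polarization turns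
  this into convergence of the entries.\<close>
lemma psd_incseq_convergent:
  fixes Z :: "nat \<Rightarrow> real^'k^'k"
  assumes psd: "\<And>k. psd (Z k)"
    and mono: "\<And>k v. v \<bullet> (Z k *v v) \<le> v \<bullet> (Z (Suc k) *v v)"
    and bound: "\<And>k. trace (Z k) \<le> b"
  obtains Z0 where "Z \<longlonglongrightarrow> Z0" "psd Z0" "\<And>k v. v \<bullet> (Z k *v v) \<le> v \<bullet> (Z0 *v v)"
proof -
  have inc: "incseq (\<lambda>k. v \<bullet> (Z k *v v))" for v
    using mono by (rule incseq_SucI)
  have "\<exists>l. (\<lambda>k. v \<bullet> (Z k *v v)) \<longlonglongrightarrow> l" for v
  proof -
    have "v \<bullet> (Z k *v v) \<le> real CARD('k)^2 * b * (v \<bullet> v)" for k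
      by (rule order_trans[OF psd_quad_le_trace[OF psd]])
        (intro mult_right_mono mult_left_mono bound, auto)
    then show ?thesis
      using incseq_convergent[OF inc[of v]] by metis
  qed
  then obtain l where l: "\<And>v. (\<lambda>k. v \<bullet> (Z k *v v)) \<longlonglongrightarrow> l v" by metis
  define Z0 where "Z0 = (\<chi> i j. (l (axis i 1 + axis j 1) - l (axis i 1) - l (axis j 1)) / 2)"
  have lim: "Z \<longlonglongrightarrow> Z0"
  proof (intro vec_tendstoI)
    fix i j
    have *: "Z k $ i $ j = ((axis i 1 + axis j 1) \<bullet> (Z k *v (axis i 1 + axis j 1))
       - axis i 1 \<bullet> (Z k *v axis i 1) - axis j 1 \<bullet> (Z k *v axis j 1)) / 2" for k
    proof -
      have "Z k $ i $ j = axis i 1 \<bullet> (Z k *v axis j 1)"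
        by (simp add: inner_axis' matrix_vector_mult_basis column_def)
      then show ?thesis
        using inner_symmetric_commute[OF psd_sym[OF psd], of "axis i 1" k "axis j 1"]
        by (simp add: matrix_vector_right_distrib inner_left_distrib inner_right_distrib)
    qed
    show "(\<lambda>k. Z k $ i $ j) \<longlonglongrightarrow> Z0 $ i $ j"
      unfolding * Z0_def by (auto intro!: tendsto_intros l)
  qed
  have quad: "(\<lambda>k. v \<bullet> (Z k *v v)) \<longlonglongrightarrow> v \<bullet> (Z0 *v v)" for v
    by (intro tendsto_inner tendsto_matrix_vector_mult lim tendsto_const)
  have "transpose Z0 = Z0"
    unfolding Z0_def by (simp add: transpose_def vec_eq_iff add.commute)
  moreover have le: "v \<bullet> (Z k *v v) \<le> v \<bullet> (Z0 *v v)" for k v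
    using inc quad by (rule incseq_le)
  moreover have "0 \<le> v \<bullet> (Z0 *v v)" for v
    using psd_nonneg[OF psd, of v 0] le[of v 0] by linarith
  ultimately show ?thesis using that lim by (auto simp: psd_def)
qed

section \<open>Matrix powers\<close>

lemma mat_pow_commute: "A ** mat_pow A k = mat_pow A k ** A"
  by (induction k) (auto simp: matrix_mul_assoc)

lemma mat_pow_add: "mat_pow A (j + k) = mat_pow A j ** mat_pow A k"
  by (induction j) (auto simp: matrix_mul_assoc[symmetric])

lemma transpose_mat_pow: "transpose (mat_pow A k) = mat_pow (transpose A) k"
  by (induction k) (auto simp: matrix_transpose_mul mat_pow_commute)

lemma invertible_mat_pow: "invertible A \<Longrightarrow> invertible (mat_pow A k)"
  for A :: "real^'k^'k"
  by (induction k) (simp_all add: invertible_mult pos_def_imp_invertible[OF pos_def_mat_1])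

lemma mat_pow_mult_inverse:
  assumes "invertible A"
  shows "mat_pow A k ** mat_pow (matrix_inv A) k = mat 1"
proof (induction k)
  case (Suc k)
  have "mat_pow A (Suc k) ** mat_pow (matrix_inv A) (Suc k)
      = (mat_pow A k ** A) ** (matrix_inv A ** mat_pow (matrix_inv A) k)"
    by (simp only: mat_pow.simps mat_pow_commute[of A])
  also have "\<dots> = mat_pow A k ** (A ** matrix_inv A) ** mat_pow (matrix_inv A) k"
    by (simp only: matrix_mul_assoc)
  finally have "mat_pow A (Suc k) ** mat_pow (matrix_inv A) (Suc k)
      = mat_pow A k ** (A ** matrix_inv A) ** mat_pow (matrix_inv A) k" .
  then show ?case using Suc matrix_inv_right[OF assms] by simp
qed simp

text \<open>The negative powers of \<open>A\<close> in the Riccati policy are harmless once multiplied by \<open>A\<^sup>D\<close>.\<close>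
lemma mat_pow_mult_powi:
  assumes "invertible A" "i \<le> j" "j \<le> D + i"
  shows "mat_pow A D ** mat_powi A (int i - int j) = mat_pow A (D + i - j)"
proof (cases "i = j")
  case False
  have "mat_pow A D = mat_pow A (D + i - j) ** mat_pow A (j - i)" if "j - i \<le> D"
    using that assms by (simp flip: mat_pow_add)
  then have "mat_pow A D = mat_pow A (D + i - j) ** mat_pow A (j - i)"
    using assms by simp
  moreover have "mat_powi A (int i - int j) = mat_pow (matrix_inv A) (j - i)"
  proof -
    have "nat (- (int i - int j)) = j - i" by simp
    then show ?thesis using False assms by (simp add: mat_powi_def)
  qed
  ultimately show ?thesis
    by (simp add: mat_pow_mult_inverse[OF assms(1)] flip: matrix_mul_assoc)
qed (simp add: mat_powi_def)

section \<open>The Riccati map\<close>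

locale delay_lq =
  fixes D :: nat and A :: "real^'n^'n" and B C :: "nat \<Rightarrow> real^'m^'n" and \<sigma> :: "nat \<Rightarrow> real"
    and R :: "real^'m^'m" and Q :: "real^'n^'n"
  assumes pos_def_Q: "pos_def Q" and pos_def_R: "pos_def R"
begin

abbreviation "L \<equiv> L_mat D A B"
abbreviation "U \<equiv> U_mat D A C \<sigma> R Q"
abbreviation "\<Psi> \<equiv> Psi_mat D A B C \<sigma> R Q"
abbreviation "G \<tau> \<equiv> mat_pow A D ** C \<tau>"

text \<open>The contribution of a control to the \<open>Z\<close>-energy through all noise channels together, regardless
  of the times at which the channels deliver it.\<close>
definition noise_energy :: "real^'n^'n \<Rightarrow> real^'m \<Rightarrow> real" where
  "noise_energy Z u = (\<Sum>\<tau>=0..D. (\<sigma> \<tau>)\<^sup>2 * ((G \<tau> *v u) \<bullet> (Z *v (G \<tau> *v u))))"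

definition stage_cost :: "real^'n \<Rightarrow> real^'m \<Rightarrow> real" where
  "stage_cost y u = y \<bullet> (Q *v y) + u \<bullet> (U *v u)"

text \<open>The right-hand side of the Bellman equation for the problem in which the noise acts on the
  current control.\<close>
definition lookahead :: "real^'n^'n \<Rightarrow> real^'n \<Rightarrow> real^'m \<Rightarrow> real" where
  "lookahead Z y u = (A *v y + L *v u) \<bullet> (Z *v (A *v y + L *v u)) + noise_energy Z u + stage_cost y u"

text \<open>The sign is chosen such that \<open>- (gain Z *v y)\<close> is the control that minimizes \<open>lookahead Z y\<close>.\<close>
definition gain :: "real^'n^'n \<Rightarrow> real^'n^'m" where
  "gain Z = matrix_inv (\<Psi> Z) ** transpose L ** Z ** A"

definition riccati_map :: "real^'n^'n \<Rightarrow> real^'n^'n" where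
  "riccati_map Z = transpose A ** Z ** A + Q
     - transpose A ** Z ** L ** matrix_inv (\<Psi> Z) ** transpose L ** Z ** A"

lemma solves_riccati_iff: "solves_riccati D A B C \<sigma> R Q Z \<longleftrightarrow> riccati_map Z = Z"
proof -
  have "- Z + X + Q - Y = 0 \<longleftrightarrow> X + Q - Y = Z" for X Y :: "real^'n^'n"
    by (auto simp: algebra_simps)
  then show ?thesis unfolding solves_riccati_def riccati_map_def .
qed

lemma Psi_eq: "\<Psi> Z = transpose L ** Z ** L
    + (\<Sum>\<tau>=0..D. (\<sigma> \<tau>)\<^sup>2 *\<^sub>R (transpose (G \<tau>) ** Z ** G \<tau>)) + U"
  by (simp add: Psi_mat_def matrix_transpose_mul transpose_mat_pow matrix_mul_assoc)

lemma pos_def_U: "pos_def U"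
proof -
  have "transpose (C \<tau>) ** mat_pow (transpose A) k ** Q ** mat_pow A k ** C \<tau>
     = transpose (mat_pow A k ** C \<tau>) ** Q ** (mat_pow A k ** C \<tau>)" for \<tau> k
    by (simp add: matrix_transpose_mul transpose_mat_pow matrix_mul_assoc)
  then show ?thesis
    unfolding U_mat_def
    by (simp only:) (intro pos_def_add_psd psd_sum psd_scaleR psd_congruence pos_def_imp_psd
        pos_def_R pos_def_Q zero_le_power2)
qed

text \<open>\<open>\<Psi>\<close> dominates \<open>U\<close>, which in turn dominates \<open>R\<close>; this makes the inverse in the Riccati
  equation meaningful.\<close>
lemma pos_def_Psi:
  assumes "psd Z" shows "pos_def (\<Psi> Z)"
proof -
  have "pos_def (U + (transpose L ** Z ** L
      + (\<Sum>\<tau>=0..D. (\<sigma> \<tau>)\<^sup>2 *\<^sub>R (transpose (G \<tau>) ** Z ** G \<tau>))))"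
    using assms by (intro pos_def_add_psd pos_def_U psd_add psd_sum psd_scaleR psd_congruence) auto
  then show ?thesis by (simp add: Psi_eq add_ac)
qed

lemma inner_Psi: "u \<bullet> (\<Psi> Z *v u) = (L *v u) \<bullet> (Z *v (L *v u)) + noise_energy Z u + u \<bullet> (U *v u)"
  unfolding Psi_eq noise_energy_def
  by (simp only: matrix_vector_mult_add_rdistrib inner_right_distrib sum_matrix_vector_mult
      inner_sum_right scaleR_matrix_vector_assoc[symmetric] inner_scaleR_right inner_congruence)

lemma noise_energy_nonneg: "psd Z \<Longrightarrow> 0 \<le> noise_energy Z u"
  unfolding noise_energy_def by (intro sum_nonneg mult_nonneg_nonneg psd_nonneg) auto

lemma stage_cost_coercive:
  obtains c where "c > 0" "\<And>y u. c * (y \<bullet> y + u \<bullet> u) \<le> stage_cost y u"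
proof -
  obtain a where a: "a > 0" "\<And>v. a * (v \<bullet> v) \<le> v \<bullet> (Q *v v)"
    using pos_def_coercive[OF pos_def_Q] by blast
  obtain b where b: "b > 0" "\<And>v. b * (v \<bullet> v) \<le> v \<bullet> (U *v v)"
    using pos_def_coercive[OF pos_def_U] by blast
  have "min a b * (y \<bullet> y + u \<bullet> u) \<le> stage_cost y u" for y u
  proof -
    have "min a b * (y \<bullet> y) \<le> a * (y \<bullet> y)" "min a b * (u \<bullet> u) \<le> b * (u \<bullet> u)"
      by (auto intro: mult_right_mono)
    then show ?thesis using a(2)[of y] b(2)[of u] by (simp add: stage_cost_def distrib_left)
  qed
  with a(1) b(1) show ?thesis using that[of "min a b"] by auto
qed

lemma stage_cost_nonneg: "0 \<le> stage_cost y u"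
  unfolding stage_cost_def
  by (intro add_nonneg_nonneg psd_nonneg pos_def_imp_psd pos_def_Q pos_def_U)

lemma Psi_gain:
  assumes "psd Z" shows "\<Psi> Z *v (gain Z *v y) = transpose L *v (Z *v (A *v y))"
proof -
  have "gain Z *v y = matrix_inv (\<Psi> Z) *v (transpose L *v (Z *v (A *v y)))"
    by (simp only: gain_def matrix_vector_mul_assoc matrix_mul_assoc)
  then show ?thesis
    using matrix_inv_mult_vector(1)[OF pos_def_imp_invertible[OF pos_def_Psi[OF assms]]] by simp
qed

text \<open>The linear term in \<open>u\<close> is \<open>2 u \<bullet> w\<close> with \<open>w = L' Z A y\<close>, and the gain is defined by
  \<open>\<Psi> (K y) = w\<close>; so the square produces this term and an excess \<open>(K y) \<bullet> w\<close>, which is exactly what the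
  Riccati map subtracts.\<close>
lemma completion_of_squares:
  assumes Z: "psd Z"
  shows "lookahead Z y u
    = y \<bullet> (riccati_map Z *v y) + (u + gain Z *v y) \<bullet> (\<Psi> Z *v (u + gain Z *v y))"
proof -
  define w where "w = transpose L *v (Z *v (A *v y))"
  define k where "k = gain Z *v y"
  have Pk: "\<Psi> Z *v k = w"
    unfolding k_def w_def using Z by (rule Psi_gain)
  have sym: "transpose (\<Psi> Z) = \<Psi> Z"
    using pos_def_Psi[OF Z] by (simp add: pos_def_def)
  have uw: "(L *v u) \<bullet> (Z *v (A *v y)) = u \<bullet> w"
    by (simp only: w_def inner_matrix_vector_left)
  have "y \<bullet> ((transpose A ** Z ** L ** matrix_inv (\<Psi> Z) ** transpose L ** Z ** A) *v y)
      = (A *v y) \<bullet> (Z *v (L *v k))"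
    by (simp only: k_def gain_def inner_matrix_vector_left matrix_vector_mul_assoc matrix_mul_assoc)
  also have "\<dots> = (L *v k) \<bullet> (Z *v (A *v y))"
    using psd_sym[OF Z] by (rule inner_symmetric_commute)
  also have "\<dots> = k \<bullet> w"
    by (simp only: w_def inner_matrix_vector_left)
  finally have "y \<bullet> (riccati_map Z *v y) = (A *v y) \<bullet> (Z *v (A *v y)) + y \<bullet> (Q *v y) - k \<bullet> w"
    unfolding riccati_map_def
    by (simp only: matrix_vector_mult_add_rdistrib matrix_vector_mult_diff_rdistrib
        inner_right_distrib inner_diff_right inner_congruence)
  moreover have "(u + k) \<bullet> (\<Psi> Z *v (u + k)) = u \<bullet> (\<Psi> Z *v u) + 2 * (u \<bullet> w) + k \<bullet> w"
    using inner_symmetric_commute[OF sym, of u k]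
    by (simp add: matrix_vector_right_distrib inner_left_distrib inner_right_distrib Pk)
  moreover have "lookahead Z y u = (A *v y) \<bullet> (Z *v (A *v y)) + 2 * (u \<bullet> w) + u \<bullet> (\<Psi> Z *v u)
      + y \<bullet> (Q *v y)"
    using inner_symmetric_commute[OF psd_sym[OF Z], of "A *v y" "L *v u"] uw
    by (simp add: lookahead_def stage_cost_def inner_Psi matrix_vector_right_distrib
        inner_left_distrib inner_right_distrib)
  ultimately show ?thesis by (simp add: k_def)
qed

lemma riccati_map_le_lookahead:
  assumes "psd Z" shows "y \<bullet> (riccati_map Z *v y) \<le> lookahead Z y u"
  using completion_of_squares[OF assms] psd_nonneg[OF pos_def_imp_psd[OF pos_def_Psi[OF assms]]]
  by simp

lemma riccati_map_eq_lookahead: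
  assumes "psd Z" shows "y \<bullet> (riccati_map Z *v y) = lookahead Z y (- (gain Z *v y))"
  by (simp add: completion_of_squares[OF assms])

lemma transpose_riccati_map:
  assumes "psd Z" shows "transpose (riccati_map Z) = riccati_map Z"
proof -
  have P: "transpose (matrix_inv (\<Psi> Z)) = matrix_inv (\<Psi> Z)"
    using pos_def_Psi[OF assms] 
    by (intro transpose_matrix_inv_symmetric pos_def_imp_invertible) (auto simp: pos_def_def)
  have "transpose Q = Q" using pos_def_Q by (simp add: pos_def_def)
  then show ?thesis
    unfolding riccati_map_def transpose_add transpose_diff matrix_transpose_mul
    by (simp add: P psd_sym[OF assms] matrix_mul_assoc)
qed

lemma psd_riccati_map:
  assumes "psd Z" shows "psd (riccati_map Z)"
proof -
  have "0 \<le> lookahead Z y u" for y u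
    unfolding lookahead_def using assms stage_cost_nonneg
    by (intro add_nonneg_nonneg psd_nonneg noise_energy_nonneg)
  then show ?thesis
    using transpose_riccati_map[OF assms] by (simp add: psd_def riccati_map_eq_lookahead[OF assms])
qed

lemma lookahead_mono:
  assumes "\<And>v. v \<bullet> (Y *v v) \<le> v \<bullet> (Z *v v)"
  shows "lookahead Y y u \<le> lookahead Z y u"
  unfolding lookahead_def noise_energy_def
  by (intro add_mono sum_mono mult_left_mono assms order_refl zero_le_power2)

text \<open>The Riccati map is a minimum of \<open>lookahead\<close> over controls, and \<open>lookahead\<close> is monotone in \<open>Z\<close>.\<close>
lemma riccati_map_mono:
  assumes "psd Y" "psd Z" "\<And>v. v \<bullet> (Y *v v) \<le> v \<bullet> (Z *v v)"
  shows "y \<bullet> (riccati_map Y *v y) \<le> y \<bullet> (riccati_map Z *v y)"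
  using riccati_map_le_lookahead[OF assms(1), of y "- (gain Z *v y)"]
    lookahead_mono[OF assms(3), of y "- (gain Z *v y)"]
  by (simp add: riccati_map_eq_lookahead[OF assms(2)])

lemma tendsto_Psi:
  assumes "(Z \<longlongrightarrow> Z0) F" shows "((\<lambda>k. \<Psi> (Z k)) \<longlongrightarrow> \<Psi> Z0) F"
  unfolding Psi_eq by (intro tendsto_intros tendsto_matrix_mult assms)

text \<open>The difference \<open>d\<close> of the two controls solves \<open>\<Psi> (Z\<^sub>k) d = r\<close> with a residual \<open>r\<close> that tends to
  zero. All \<open>\<Psi> (Z\<^sub>k)\<close> dominate the same positive definite \<open>U\<close>, so the norm of \<open>d\<close> is at most a fixed
  multiple of that of \<open>r\<close>.\<close>
lemma tendsto_gain:
  assumes psd: "\<And>k. psd (Z k)" "psd Z0" and lim: "Z \<longlonglongrightarrow> Z0"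
  shows "(\<lambda>k. gain (Z k) *v y) \<longlonglongrightarrow> gain Z0 *v y"
proof -
  obtain c where c: "c > 0" "\<And>v. c * (v \<bullet> v) \<le> v \<bullet> (U *v v)"
    using pos_def_coercive[OF pos_def_U] by blast
  define d where "d k = gain (Z k) *v y - gain Z0 *v y" for k
  define r where "r k = transpose L *v (Z k *v (A *v y)) - \<Psi> (Z k) *v (gain Z0 *v y)" for k
  have "r \<longlonglongrightarrow> transpose L *v (Z0 *v (A *v y)) - \<Psi> Z0 *v (gain Z0 *v y)"
    unfolding r_def by (intro tendsto_intros tendsto_matrix_vector_mult tendsto_Psi lim)
  then have r: "r \<longlonglongrightarrow> 0"
    by (simp add: Psi_gain[OF psd(2)] del: transpose_matrix_vector)
  have "norm (d k) \<le> norm (r k) / c" for k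
  proof (cases "d k = 0")
    case False
    have "c * (norm (d k))\<^sup>2 \<le> d k \<bullet> (\<Psi> (Z k) *v d k)"
      using c(2)[of "d k"] psd_nonneg[OF psd(1), of "L *v d k" k] noise_energy_nonneg[OF psd(1), of k "d k"]
      by (simp add: inner_Psi power2_norm_eq_inner)
    also have "\<dots> = d k \<bullet> r k"
      unfolding d_def r_def by (simp only: matrix_vector_mult_diff_distrib Psi_gain[OF psd(1)])
    also have "\<dots> \<le> norm (d k) * norm (r k)"
      by (rule norm_cauchy_schwarz)
    finally have "norm (d k) * (c * norm (d k)) \<le> norm (d k) * norm (r k)"
      by (simp add: power2_eq_square algebra_simps)
    moreover have "0 < norm (d k)"
      using False by simp
    ultimately have "c * norm (d k) \<le> norm (r k)"
      by (rule mult_left_le_imp_le)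
    then show ?thesis using c(1) by (simp add: field_simps)
  qed (use c(1) in auto)
  moreover have "(\<lambda>k. norm (r k) / c) \<longlonglongrightarrow> 0"
    using tendsto_divide_zero[OF tendsto_norm_zero[OF r]] .
  ultimately have "d \<longlonglongrightarrow> 0"
    by (intro Lim_null_comparison[of d "\<lambda>k. norm (r k) / c"] always_eventually allI)
  then show ?thesis unfolding d_def by (rule Lim_null[THEN iffD2])
qed

lemma tendsto_lookahead:
  assumes "Z \<longlonglongrightarrow> Z0" "u \<longlonglongrightarrow> u0"
  shows "(\<lambda>k. lookahead (Z k) y (u k)) \<longlonglongrightarrow> lookahead Z0 y u0"
  unfolding lookahead_def noise_energy_def stage_cost_def
  by (intro tendsto_intros tendsto_inner tendsto_matrix_vector_mult assms)

text \<open>Value iteration from \<open>0\<close>. Its iterates increase by monotonicity of the Riccati map, so they are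
  subsolutions and the bound applies to them; the limit is a fixed point by continuity.\<close>
lemma riccati_fixed_point:
  assumes bound: "\<And>Z. psd Z \<Longrightarrow> (\<And>y. y \<bullet> (Z *v y) \<le> y \<bullet> (riccati_map Z *v y)) \<Longrightarrow> trace Z \<le> b"
  shows "\<exists>Z. pos_def Z \<and> riccati_map Z = Z"
proof -
  define Z where "Z k = (riccati_map ^^ k) 0" for k
  have Z_Suc: "Z (Suc k) = riccati_map (Z k)" for k
    by (simp add: Z_def)
  have psd: "psd (Z k)" for k
    by (induction k) (auto simp: Z_def intro: psd_riccati_map)
  have mono: "y \<bullet> (Z k *v y) \<le> y \<bullet> (Z (Suc k) *v y)" for k y
  proof (induction k arbitrary: y)
    case 0
    then show ?case using psd_nonneg[OF psd[of 1]] by (simp add: Z_def)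
  next
    case (Suc k)
    show ?case
      using riccati_map_mono[OF psd psd, of k "Suc k" y] Suc by (simp only: Z_Suc)
  qed
  have "trace (Z k) \<le> b" for k
    using bound[OF psd] mono by (simp add: Z_Suc)
  then obtain Z0 where lim: "Z \<longlonglongrightarrow> Z0" and psd0: "psd Z0"
    and le: "\<And>k v. v \<bullet> (Z k *v v) \<le> v \<bullet> (Z0 *v v)"
    using psd_incseq_convergent[of Z b, OF psd mono] by blast
  have "y \<bullet> (riccati_map Z0 *v y) = y \<bullet> (Z0 *v y)" for y
  proof (rule LIMSEQ_unique)
    show "(\<lambda>k. y \<bullet> (Z (Suc k) *v y)) \<longlonglongrightarrow> y \<bullet> (Z0 *v y)"
      by (intro tendsto_inner tendsto_const tendsto_matrix_vector_mult LIMSEQ_Suc[OF lim])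
    show "(\<lambda>k. y \<bullet> (Z (Suc k) *v y)) \<longlonglongrightarrow> y \<bullet> (riccati_map Z0 *v y)"
      unfolding Z_Suc riccati_map_eq_lookahead[OF psd] riccati_map_eq_lookahead[OF psd0]
      by (intro tendsto_lookahead tendsto_minus tendsto_gain psd psd0 lim)
  qed
  then have fix0: "riccati_map Z0 = Z0"
    by (rule symmetric_eqI[OF transpose_riccati_map[OF psd0] psd_sym[OF psd0]])
  \<comment> \<open>The limit dominates the first iterate, which is \<open>Q\<close>; hence it is definite.\<close>
  have "riccati_map 0 = Q"
    by (simp add: riccati_map_def)
  then have "v \<bullet> (Q *v v) \<le> v \<bullet> (Z0 *v v)" for v
    using le[of v 1] by (simp add: Z_def)
  then have "pos_def Z0"
    using pos_def_Q psd_sym[OF psd0] unfolding pos_def_def by (meson less_le_trans)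
  with fix0 show ?thesis by blast
qed

end

section \<open>Noise, past and square-integrable vectors\<close>

locale delay_noise = prob_space M
  for M :: "'w measure" +
  fixes D :: nat and \<sigma> :: "nat \<Rightarrow> real" and \<omega> :: "nat \<Rightarrow> nat \<Rightarrow> 'w \<Rightarrow> real"
  assumes noise: "noise M D \<sigma> \<omega>"
begin

definition events_of :: "nat \<times> nat \<Rightarrow> 'w set set" where
  "events_of i = {(case i of (\<tau>, s) \<Rightarrow> \<omega> \<tau> s) -` S \<inter> space M | S. S \<in> sets borel}"

text \<open>The noise strictly before \<open>t\<close>, which is all the randomness that \<open>x\<^sub>t\<close> and \<open>u\<^sub>t\<close> depend on;
  the filtration of the admissible controls at time \<open>t\<close> is \<open>past (Suc t)\<close>.\<close>
definition past :: "nat \<Rightarrow> 'w measure" where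
  "past t = sigma (space M) (\<Union>i\<in>{..D} \<times> {..<t}. events_of i)"

definition present :: "nat \<Rightarrow> 'w measure" where
  "present t = sigma (space M) (\<Union>i\<in>{..D} \<times> {t}. events_of i)"

lemma noise_filtration_eq_past: "noise_filtration M D \<omega> t = past (Suc t)"
proof -
  have "(\<Union>i\<in>{..D} \<times> {..<Suc t}. events_of i) = (\<Union>s\<in>{..t}. \<Union>\<tau>\<in>{..D}. events_of (\<tau>, s))"
    by (simp add: lessThan_Suc_atMost) blast
  also have "\<dots> = (\<Union>s\<in>{..t}. \<Union>\<tau>\<in>{..D}. {\<omega> \<tau> s -` S \<inter> space M | S. S \<in> sets borel})"
    by (simp add: events_of_def)
  finally have "(\<Union>s\<in>{..t}. \<Union>\<tau>\<in>{..D}. {\<omega> \<tau> s -` S \<inter> space M | S. S \<in> sets borel})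
      = (\<Union>i\<in>{..D} \<times> {..<Suc t}. events_of i)" ..
  then show ?thesis by (simp add: noise_filtration_def past_def)
qed

lemma measurable_noise: "\<tau> \<le> D \<Longrightarrow> \<omega> \<tau> t \<in> borel_measurable M"
  using noise by (auto simp: noise_def indep_vars_def)

lemma events_of_subset: "i \<in> {..D} \<times> UNIV \<Longrightarrow> events_of i \<subseteq> events"
  using measurable_noise by (auto simp: events_of_def)

lemma
  shows space_past [simp]: "space (past t) = space M"
    and space_present [simp]: "space (present t) = space M"
    and sets_past: "sets (past t) = sigma_sets (space M) (\<Union>i\<in>{..D} \<times> {..<t}. events_of i)"
    and sets_present: "sets (present t) = sigma_sets (space M) (\<Union>i\<in>{..D} \<times> {t}. events_of i)"
proof -
  have "(\<Union>i\<in>{..D} \<times> S. events_of i) \<subseteq> Pow (space M)" for S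
    by (auto simp: events_of_def)
  then show "space (past t) = space M" "space (present t) = space M"
    "sets (past t) = sigma_sets (space M) (\<Union>i\<in>{..D} \<times> {..<t}. events_of i)"
    "sets (present t) = sigma_sets (space M) (\<Union>i\<in>{..D} \<times> {t}. events_of i)"
    unfolding past_def present_def by (simp_all add: sets_measure_of space_measure_of)
qed

lemma subalgebra_past: "subalgebra M (past t)"
  unfolding subalgebra_def sets_past
  using events_of_subset by (auto intro!: sets.sigma_sets_subset)

lemma subalgebra_past_mono: "s \<le> t \<Longrightarrow> subalgebra (past t) (past s)"
  unfolding subalgebra_def sets_past space_past
  by (intro conjI refl sigma_sets_mono' UN_mono) auto

lemma measurable_noise_past:
  assumes "\<tau> \<le> D" "s < t" shows "\<omega> \<tau> s \<in> borel_measurable (past t)"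
proof (rule measurableI)
  fix S :: "real set" assume "S \<in> sets borel"
  then have "\<omega> \<tau> s -` S \<inter> space M \<in> events_of (\<tau>, s)"
    by (auto simp: events_of_def)
  then show "\<omega> \<tau> s -` S \<inter> space (past t) \<in> sets (past t)"
    unfolding sets_past space_past using assms by (intro sigma_sets.Basic) auto
qed simp

lemma measurable_noise_present:
  assumes "\<tau> \<le> D" shows "\<omega> \<tau> t \<in> borel_measurable (present t)"
proof (rule measurableI)
  fix S :: "real set" assume "S \<in> sets borel"
  then have "\<omega> \<tau> t -` S \<inter> space M \<in> events_of (\<tau>, t)"
    by (auto simp: events_of_def)
  then show "\<omega> \<tau> t -` S \<inter> space (present t) \<in> sets (present t)"
    unfolding sets_present space_present using assms by (intro sigma_sets.Basic) auto
qed simp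

text \<open>The two independence hypotheses, across channels for whole sequences and across time in each
  channel, combine to joint independence of all noise variables: a finite intersection of events is
  grouped by channel, and each group is an event of one noise sequence.\<close>
lemma indep_vars_noise: "indep_vars (\<lambda>_. borel) (\<lambda>(\<tau>, s). \<omega> \<tau> s) ({..D} \<times> UNIV)"
proof -
  have seq: "indep_vars (\<lambda>_. PiM UNIV (\<lambda>_::nat. borel)) (\<lambda>\<tau> p t. \<omega> \<tau> t p) {..D}"
    and chan: "\<And>\<tau>. \<tau> \<le> D \<Longrightarrow> indep_vars (\<lambda>_. borel) (\<omega> \<tau>) UNIV"
    using noise by (auto simp: noise_def)
  have "indep_sets events_of ({..D} \<times> UNIV)"
  proof (rule indep_setsI)
    fix A J assume J: "J \<noteq> {}" "J \<subseteq> {..D} \<times> (UNIV :: nat set)" "finite J"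
      and A: "\<forall>j\<in>J. A j \<in> events_of j"
    obtain S where S: "\<And>\<tau> s. (\<tau>, s) \<in> J \<Longrightarrow> S \<tau> s \<in> sets borel"
        "\<And>\<tau> s. (\<tau>, s) \<in> J \<Longrightarrow> A (\<tau>, s) = \<omega> \<tau> s -` S \<tau> s \<inter> space M"
    proof -
      have "\<forall>\<tau> s. \<exists>X. (\<tau>, s) \<in> J \<longrightarrow> X \<in> sets borel \<and> A (\<tau>, s) = \<omega> \<tau> s -` X \<inter> space M"
        using A by (fastforce simp: events_of_def)
      then show ?thesis using that by metis
    qed
    define T where "T = fst ` J"
    define N where "N \<tau> = {s. (\<tau>, s) \<in> J}" for \<tau>
    have J_eq: "J = Sigma T N"
      by (auto simp: T_def N_def image_iff) force
    have T: "T \<noteq> {}" "finite T" "T \<subseteq> {..D}"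
      using J by (auto simp: T_def)
    have N: "N \<tau> \<noteq> {}" "finite (N \<tau>)" if "\<tau> \<in> T" for \<tau>
    proof -
      show "N \<tau> \<noteq> {}" using that by (auto simp: T_def N_def)
      have "N \<tau> = snd ` (J \<inter> {\<tau>} \<times> UNIV)" by (force simp: N_def)
      then show "finite (N \<tau>)" using J(3) by simp
    qed
    \<comment> \<open>All constraints on one channel as a single measurable set of sequences.\<close>
    define P where "P \<tau> = {f \<in> space (PiM UNIV (\<lambda>_::nat. borel)). \<forall>s\<in>N \<tau>. f s \<in> S \<tau> s}" for \<tau>
    have P: "P \<tau> \<in> sets (PiM UNIV (\<lambda>_::nat. borel))" if "\<tau> \<in> T" for \<tau>
    proof -
      have [measurable]: "S \<tau> s \<in> sets borel" if "s \<in> N \<tau>" for s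
        using S that by (auto simp: N_def)
      show ?thesis
        unfolding P_def using N[OF that] by measurable
    qed
    have "(\<Inter>j\<in>J. A j) = (\<Inter>\<tau>\<in>T. \<Inter>s\<in>N \<tau>. A (\<tau>, s))"
      unfolding J_eq by auto
    also have "\<dots> = (\<Inter>\<tau>\<in>T. \<Inter>s\<in>N \<tau>. \<omega> \<tau> s -` S \<tau> s \<inter> space M)"
      using S(2) by (intro INF_cong refl) (auto simp: N_def)
    also have "\<dots> = (\<Inter>\<tau>\<in>T. (\<lambda>p t. \<omega> \<tau> t p) -` P \<tau> \<inter> space M)"
      using N(1) by (intro INF_cong) (auto simp: P_def space_PiM)
    finally have "prob (\<Inter>j\<in>J. A j) = (\<Prod>\<tau>\<in>T. prob ((\<lambda>p t. \<omega> \<tau> t p) -` P \<tau> \<inter> space M))"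
      using indep_varsD[OF seq T P] by simp
    also have "\<dots> = (\<Prod>\<tau>\<in>T. \<Prod>s\<in>N \<tau>. prob (A (\<tau>, s)))"
    proof (intro prod.cong refl)
      fix \<tau> assume \<tau>: "\<tau> \<in> T"
      have "(\<lambda>p t. \<omega> \<tau> t p) -` P \<tau> \<inter> space M = (\<Inter>s\<in>N \<tau>. \<omega> \<tau> s -` S \<tau> s \<inter> space M)"
        using N(1)[OF \<tau>] by (auto simp: P_def space_PiM)
      also have "prob \<dots> = (\<Prod>s\<in>N \<tau>. prob (\<omega> \<tau> s -` S \<tau> s \<inter> space M))"
        using N[OF \<tau>] \<tau> T S by (intro indep_varsD[OF chan]) (auto simp: N_def)
      also have "\<dots> = (\<Prod>s\<in>N \<tau>. prob (A (\<tau>, s)))"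
        using S(2) by (intro prod.cong) (auto simp: N_def)
      finally show "prob ((\<lambda>p t. \<omega> \<tau> t p) -` P \<tau> \<inter> space M) = (\<Prod>s\<in>N \<tau>. prob (A (\<tau>, s)))" .
    qed
    also have "\<dots> = (\<Prod>j\<in>J. prob (A j))"
      unfolding J_eq using T N by (subst prod.Sigma) (auto intro!: prod.cong)
    finally show "prob (\<Inter>j\<in>J. A j) = (\<Prod>j\<in>J. prob (A j))" .
  qed (use events_of_subset in auto)
  then show ?thesis
    unfolding indep_vars_def2 events_of_def using measurable_noise by auto
qed

text \<open>Disjoint blocks of a jointly independent family generate independent sigma-algebras.\<close>
lemma indep_past_present:
  assumes f: "f \<in> borel_measurable (past t)" and g: "g \<in> borel_measurable (present t)"
  shows "indep_var borel f borel g"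
proof -
  let ?I = "\<lambda>b. {..D} \<times> (if b then {..<t} else {t})"
  have "indep_sets (\<lambda>b. sigma_sets (space M) (\<Union>i\<in>?I b. events_of i)) UNIV"
  proof (rule indep_sets_collect_sigma)
    show "indep_sets events_of (\<Union>b\<in>UNIV. ?I b)"
      using indep_vars_noise unfolding indep_vars_def2 events_of_def[abs_def, symmetric]
      by (elim conjE, rule_tac indep_sets_mono_index[of _ "{..D} \<times> UNIV"]) auto
    show "Int_stable (events_of i)" for i
      unfolding Int_stable_def events_of_def
    proof safe
      fix X Y :: "real set" assume "X \<in> sets borel" "Y \<in> sets borel"
      then show "\<exists>S. (case i of (\<tau>, s) \<Rightarrow> \<omega> \<tau> s) -` X \<inter> space M \<inter> ((case i of (\<tau>, s) \<Rightarrow> \<omega> \<tau> s) -` Y \<inter> space M)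
          = (case i of (\<tau>, s) \<Rightarrow> \<omega> \<tau> s) -` S \<inter> space M \<and> S \<in> sets borel"
        by (intro exI[of _ "X \<inter> Y"]) auto
    qed
    show "disjoint_family ?I"
      by (auto simp: disjoint_family_on_def)
  qed
  then have "indep_set (sets (past t)) (sets (present t))"
    unfolding indep_set_def sets_past sets_present
    by (rule indep_sets_cong[THEN iffD1, rotated 2]) (auto split: bool.split)
  moreover have "sigma_sets (space M) {f -` A \<inter> space M |A. A \<in> sets borel} \<subseteq> sets (past t)"
    using measurable_sets[OF f] by (intro sets.sigma_sets_subset[of _ "past t", simplified]) auto
  moreover have "sigma_sets (space M) {g -` A \<inter> space M |A. A \<in> sets borel} \<subseteq> sets (present t)"
    using measurable_sets[OF g] by (intro sets.sigma_sets_subset[of _ "present t", simplified]) auto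
  ultimately have "indep_set (sigma_sets (space M) {f -` A \<inter> space M |A. A \<in> sets borel})
      (sigma_sets (space M) {g -` A \<inter> space M |A. A \<in> sets borel})"
    unfolding indep_sets2_eq by blast
  moreover have "subalgebra M (present t)"
    unfolding subalgebra_def sets_present
    using events_of_subset by (auto intro!: sets.sigma_sets_subset)
  ultimately show ?thesis
    unfolding indep_var_eq using f g measurable_from_subalg subalgebra_past by blast
qed

lemma indep_channels:
  assumes "\<tau> \<le> D" "\<rho> \<le> D" "\<tau> \<noteq> \<rho>"
  shows "indep_var borel (\<omega> \<tau> t) borel (\<omega> \<rho> t)"
proof -
  have "indep_var (PiM {(\<tau>, t)} (\<lambda>_. borel)) (\<lambda>p. \<lambda>i\<in>{(\<tau>, t)}. (case i of (\<tau>, s) \<Rightarrow> \<omega> \<tau> s) p)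
      (PiM {(\<rho>, t)} (\<lambda>_. borel)) (\<lambda>p. \<lambda>i\<in>{(\<rho>, t)}. (case i of (\<tau>, s) \<Rightarrow> \<omega> \<tau> s) p)"
    using assms by (intro indep_var_restrict[OF indep_vars_noise]) auto
  then have "indep_var borel ((\<lambda>f. f (\<tau>, t)) \<circ> (\<lambda>p. \<lambda>i\<in>{(\<tau>, t)}. (case i of (\<tau>, s) \<Rightarrow> \<omega> \<tau> s) p))
      borel ((\<lambda>f. f (\<rho>, t)) \<circ> (\<lambda>p. \<lambda>i\<in>{(\<rho>, t)}. (case i of (\<tau>, s) \<Rightarrow> \<omega> \<tau> s) p))"
    by (rule indep_var_compose) auto
  then show ?thesis by (simp add: comp_def)
qed

lemma integrable_noise:
  assumes "\<tau> \<le> D" shows "integrable M (\<omega> \<tau> t)"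
proof (rule square_integrable_imp_integrable)
  show "integrable M (\<lambda>p. (\<omega> \<tau> t p)\<^sup>2)" using noise assms by (auto simp: noise_def)
qed (use measurable_noise assms in auto)

lemma noise_products:
  assumes "\<tau> \<le> D" "\<rho> \<le> D"
  shows "integrable M (\<lambda>p. \<omega> \<tau> t p * \<omega> \<rho> t p)"
    and "(LINT p|M. \<omega> \<tau> t p * \<omega> \<rho> t p) = (\<sigma> \<tau>)\<^sup>2 * of_bool (\<tau> = \<rho>)"
proof -
  have mean: "(LINT p|M. \<omega> \<tau> t p) = 0" and sq: "integrable M (\<lambda>p. (\<omega> \<tau> t p)\<^sup>2)"
    and var: "(LINT p|M. \<omega> \<tau> t p * \<omega> \<tau> t p) = (\<sigma> \<tau>)\<^sup>2"
    using noise assms by (auto simp: noise_def)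
  show "integrable M (\<lambda>p. \<omega> \<tau> t p * \<omega> \<rho> t p)"
    "(LINT p|M. \<omega> \<tau> t p * \<omega> \<rho> t p) = (\<sigma> \<tau>)\<^sup>2 * of_bool (\<tau> = \<rho>)"
    using sq var mean indep_channels[OF assms, of t] assms
      indep_var_integrable[of "\<omega> \<tau> t" "\<omega> \<rho> t"] indep_var_lebesgue_integral[of "\<omega> \<tau> t" "\<omega> \<rho> t"]
    by (cases "\<tau> = \<rho>"; simp add: power2_eq_square integrable_noise)+
qed

lemma noise_times_past:
  assumes "\<tau> \<le> D" "f \<in> borel_measurable (past t)" "integrable M f"
  shows "integrable M (\<lambda>p. \<omega> \<tau> t p * f p)" and "(LINT p|M. \<omega> \<tau> t p * f p) = 0"
proof -
  have "indep_var borel f borel (\<omega> \<tau> t)"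
    by (rule indep_past_present[OF assms(2) measurable_noise_present[OF assms(1)]])
  moreover have "(LINT p|M. \<omega> \<tau> t p) = 0"
    using noise assms by (auto simp: noise_def)
  ultimately show "integrable M (\<lambda>p. \<omega> \<tau> t p * f p)" "(LINT p|M. \<omega> \<tau> t p * f p) = 0"
    using indep_var_integrable[of f "\<omega> \<tau> t"] indep_var_lebesgue_integral[of f "\<omega> \<tau> t"]
      assms integrable_noise by (simp_all add: mult.commute)
qed

lemma noise_pair_times_past:
  assumes "\<tau> \<le> D" "\<rho> \<le> D" "f \<in> borel_measurable (past t)" "integrable M f"
  shows "integrable M (\<lambda>p. \<omega> \<tau> t p * \<omega> \<rho> t p * f p)"
    and "(LINT p|M. \<omega> \<tau> t p * \<omega> \<rho> t p * f p) = (\<sigma> \<tau>)\<^sup>2 * of_bool (\<tau> = \<rho>) * (LINT p|M. f p)"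
proof -
  have "indep_var borel f borel (\<lambda>p. \<omega> \<tau> t p * \<omega> \<rho> t p)"
    by (rule indep_past_present[OF assms(3) borel_measurable_times[OF
          measurable_noise_present[OF assms(1)] measurable_noise_present[OF assms(2)]]])
  then show "integrable M (\<lambda>p. \<omega> \<tau> t p * \<omega> \<rho> t p * f p)"
    "(LINT p|M. \<omega> \<tau> t p * \<omega> \<rho> t p * f p) = (\<sigma> \<tau>)\<^sup>2 * of_bool (\<tau> = \<rho>) * (LINT p|M. f p)"
    using indep_var_integrable[of f "\<lambda>p. \<omega> \<tau> t p * \<omega> \<rho> t p"]
      indep_var_lebesgue_integral[of f "\<lambda>p. \<omega> \<tau> t p * \<omega> \<rho> t p"]
      assms noise_products[of \<tau> \<rho> t] by (simp_all add: mult.commute[of _ "f _"])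
qed

definition L2_past :: "nat \<Rightarrow> ('w \<Rightarrow> real^'k) \<Rightarrow> bool" where
  "L2_past t f \<longleftrightarrow> f \<in> borel_measurable (past t) \<and> integrable M (\<lambda>p. f p \<bullet> f p)"

lemma L2_past_measurable: "L2_past t f \<Longrightarrow> f \<in> borel_measurable M"
  using measurable_from_subalg[OF subalgebra_past] by (auto simp: L2_past_def)

lemma L2_past_mono: "L2_past s f \<Longrightarrow> s \<le> t \<Longrightarrow> L2_past t f"
  using measurable_from_subalg[OF subalgebra_past_mono] by (auto simp: L2_past_def)

lemma L2_past_inner:
  fixes f g :: "'w \<Rightarrow> real^'k"
  assumes "L2_past t f" "L2_past t g"
  shows "(\<lambda>p. f p \<bullet> g p) \<in> borel_measurable (past t)" "integrable M (\<lambda>p. f p \<bullet> g p)"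
proof -
  show "(\<lambda>p. f p \<bullet> g p) \<in> borel_measurable (past t)"
    using assms by (auto simp: L2_past_def)
  have "integrable M (\<lambda>p. f p \<bullet> f p + g p \<bullet> g p)"
    using assms by (auto simp: L2_past_def)
  moreover have "norm (f p \<bullet> g p) \<le> norm (f p \<bullet> f p + g p \<bullet> g p)" for p
  proof -
    have "0 \<le> (f p + g p) \<bullet> (f p + g p)" "0 \<le> (f p - g p) \<bullet> (f p - g p)"
      by simp_all
    then have "\<bar>2 * (f p \<bullet> g p)\<bar> \<le> f p \<bullet> f p + g p \<bullet> g p"
      by (simp add: inner_left_distrib inner_right_distrib inner_diff_left inner_diff_right inner_commute)
    then show ?thesis by simp
  qed
  moreover have "(\<lambda>p. f p \<bullet> g p) \<in> borel_measurable M"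
    using assms[THEN L2_past_measurable] by measurable
  ultimately show "integrable M (\<lambda>p. f p \<bullet> g p)"
    by - (rule Bochner_Integration.integrable_bound[of M "\<lambda>p. f p \<bullet> f p + g p \<bullet> g p"], auto)
qed

lemma L2_past_cong: "(\<And>p. p \<in> space M \<Longrightarrow> f p = g p) \<Longrightarrow> L2_past t f \<longleftrightarrow> L2_past t g"
  unfolding L2_past_def
  by (intro conj_cong measurable_cong Bochner_Integration.integrable_cong) auto

lemma L2_past_add:
  assumes "L2_past t f" "L2_past t g" shows "L2_past t (\<lambda>p. f p + g p)"
proof -
  have "integrable M (\<lambda>p. f p \<bullet> f p + 2 * (f p \<bullet> g p) + g p \<bullet> g p)"
    using L2_past_inner(2)[OF assms(1,1)] L2_past_inner(2)[OF assms] L2_past_inner(2)[OF assms(2,2)]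
    by auto
  moreover have "f p \<bullet> f p + 2 * (f p \<bullet> g p) + g p \<bullet> g p = (f p + g p) \<bullet> (f p + g p)" for p
    by (simp add: inner_left_distrib inner_right_distrib inner_commute)
  ultimately show ?thesis
    using assms by (auto simp: L2_past_def)
qed

lemma L2_past_const: "L2_past t (\<lambda>_. v)"
  by (auto simp: L2_past_def)

lemma L2_past_sum: "(\<And>i. i \<in> I \<Longrightarrow> L2_past t (f i)) \<Longrightarrow> L2_past t (\<lambda>p. \<Sum>i\<in>I. f i p)"
  by (induction I rule: infinite_finite_induct) (auto intro: L2_past_add L2_past_const)

lemma L2_past_matrix:
  fixes X :: "real^'a^'b"
  assumes "L2_past t f" shows "L2_past t (\<lambda>p. X *v f p)"
proof -
  have [measurable]: "(\<lambda>v. X *v v) \<in> borel_measurable borel"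
    by (intro borel_measurable_continuous_onI linear_continuous_on matrix_vector_mul_bounded_linear)
  have fm [measurable]: "f \<in> borel_measurable (past t)" "f \<in> borel_measurable M"
    using assms L2_past_measurable by (auto simp: L2_past_def)
  have "norm ((X *v v) \<bullet> (X *v v)) \<le> norm ((onorm (\<lambda>v. X *v v))\<^sup>2 * (v \<bullet> v))" for v
    using power_mono[OF onorm[OF matrix_vector_mul_bounded_linear, of X v], of 2]
    by (simp add: power_mult_distrib flip: power2_norm_eq_inner)
  moreover have "integrable M (\<lambda>p. (onorm (\<lambda>v. X *v v))\<^sup>2 * (f p \<bullet> f p))"
    using assms by (auto simp: L2_past_def)
  ultimately have "integrable M (\<lambda>p. (X *v f p) \<bullet> (X *v f p))"
    by - (rule Bochner_Integration.integrable_bound[of M "\<lambda>p. (onorm (\<lambda>v. X *v v))\<^sup>2 * (f p \<bullet> f p)"], auto)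
  then show ?thesis by (auto simp: L2_past_def)
qed

lemma integrable_quadratic: "L2_past t f \<Longrightarrow> L2_past t g \<Longrightarrow> integrable M (\<lambda>p. f p \<bullet> (Z *v g p))"
  for f :: "'w \<Rightarrow> real^'a" and g :: "'w \<Rightarrow> real^'b"
  by (intro L2_past_inner L2_past_matrix)

lemma L2_past_noise:
  assumes "\<tau> \<le> D" "L2_past t f" shows "L2_past (Suc t) (\<lambda>p. \<omega> \<tau> t p *\<^sub>R f p)"
proof -
  have "integrable M (\<lambda>p. \<omega> \<tau> t p * \<omega> \<tau> t p * (f p \<bullet> f p))"
    using assms by (intro noise_pair_times_past L2_past_inner) (auto simp: L2_past_def)
  moreover have "f \<in> borel_measurable (past (Suc t))" "\<omega> \<tau> t \<in> borel_measurable (past (Suc t))"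
    using L2_past_mono[OF assms(2), of "Suc t"] measurable_noise_past assms by (auto simp: L2_past_def)
  ultimately show ?thesis by (auto simp: L2_past_def mult.assoc)
qed

text \<open>Only the diagonal noise terms survive: a single noise variable, or a product of two different
  ones, is centred and independent of its coefficient, which is determined by the past.\<close>
lemma expectation_noisy_quadratic:
  fixes a :: "'w \<Rightarrow> real^'k" and g :: "nat \<Rightarrow> 'w \<Rightarrow> real^'k"
  assumes a: "L2_past t a" and g: "\<And>\<tau>. \<tau> \<le> D \<Longrightarrow> L2_past t (g \<tau>)"
  shows "(LINT p|M. (a p + (\<Sum>\<tau>=0..D. \<omega> \<tau> t p *\<^sub>R g \<tau> p)) \<bullet> (Z *v (a p + (\<Sum>\<tau>=0..D. \<omega> \<tau> t p *\<^sub>R g \<tau> p))))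
    = (LINT p|M. a p \<bullet> (Z *v a p)) + (\<Sum>\<tau>=0..D. (\<sigma> \<tau>)\<^sup>2 * (LINT p|M. g \<tau> p \<bullet> (Z *v g \<tau> p)))"
proof -
  have *: "(a p + (\<Sum>\<tau>=0..D. \<omega> \<tau> t p *\<^sub>R g \<tau> p)) \<bullet> (Z *v (a p + (\<Sum>\<tau>=0..D. \<omega> \<tau> t p *\<^sub>R g \<tau> p)))
     = a p \<bullet> (Z *v a p) + (\<Sum>\<tau>=0..D. \<omega> \<tau> t p * (a p \<bullet> (Z *v g \<tau> p)))
       + ((\<Sum>\<tau>=0..D. \<omega> \<tau> t p * (g \<tau> p \<bullet> (Z *v a p)))
       + (\<Sum>\<tau>=0..D. \<Sum>\<rho>=0..D. \<omega> \<tau> t p * \<omega> \<rho> t p * (g \<tau> p \<bullet> (Z *v g \<rho> p))))" for p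
    unfolding matrix_vector_right_distrib inner_left_distrib inner_right_distrib
      matrix_vector_mult_sum matrix_vector_mult_scaleR inner_sum_left
    by (simp add: inner_sum_right sum_distrib_left mult.assoc mult.left_commute)
  have quad: "(\<lambda>p. f p \<bullet> (Z *v h p)) \<in> borel_measurable (past t)" "integrable M (\<lambda>p. f p \<bullet> (Z *v h p))"
    if "L2_past t f" "L2_past t h" for f h
    using that by (auto intro!: L2_past_inner L2_past_matrix)
  have one: "integrable M (\<lambda>p. \<omega> \<tau> t p * (f p \<bullet> (Z *v h p)))"
      "(LINT p|M. \<omega> \<tau> t p * (f p \<bullet> (Z *v h p))) = 0"
    if "\<tau> \<in> {0..D}" "L2_past t f" "L2_past t h" for \<tau> f h
    using that quad noise_times_past by auto
  have two: "integrable M (\<lambda>p. \<omega> \<tau> t p * \<omega> \<rho> t p * (f p \<bullet> (Z *v h p)))"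
      "(LINT p|M. \<omega> \<tau> t p * \<omega> \<rho> t p * (f p \<bullet> (Z *v h p)))
        = (\<sigma> \<tau>)\<^sup>2 * of_bool (\<tau> = \<rho>) * (LINT p|M. f p \<bullet> (Z *v h p))"
    if "\<tau> \<in> {0..D}" "\<rho> \<in> {0..D}" "L2_past t f" "L2_past t h" for \<tau> \<rho> f h
    using that quad noise_pair_times_past by auto
  have g': "L2_past t (g \<tau>)" if "\<tau> \<in> {0..D}" for \<tau>
    using g that by auto
  note ints = one(1)[OF _ a g'] one(1)[OF _ g' a] two(1)[OF _ _ g' g'] quad(2)[OF a a]
  have "(LINT p|M. (\<Sum>\<tau>=0..D. \<Sum>\<rho>=0..D. \<omega> \<tau> t p * \<omega> \<rho> t p * (g \<tau> p \<bullet> (Z *v g \<rho> p))))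
      = (\<Sum>\<tau>=0..D. \<Sum>\<rho>=0..D. (\<sigma> \<tau>)\<^sup>2 * of_bool (\<tau> = \<rho>) * (LINT p|M. g \<tau> p \<bullet> (Z *v g \<rho> p)))"
  proof -
    have inner: "integrable M (\<lambda>p. \<Sum>\<rho>=0..D. \<omega> \<tau> t p * \<omega> \<rho> t p * (g \<tau> p \<bullet> (Z *v g \<rho> p)))"
      if "\<tau> \<in> {0..D}" for \<tau>
      using that by (intro Bochner_Integration.integrable_sum ints)
    have "(LINT p|M. (\<Sum>\<rho>=0..D. \<omega> \<tau> t p * \<omega> \<rho> t p * (g \<tau> p \<bullet> (Z *v g \<rho> p))))
        = (\<Sum>\<rho>=0..D. (\<sigma> \<tau>)\<^sup>2 * of_bool (\<tau> = \<rho>) * (LINT p|M. g \<tau> p \<bullet> (Z *v g \<rho> p)))"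
      if "\<tau> \<in> {0..D}" for \<tau>
      using that by (subst Bochner_Integration.integral_sum)
        (auto intro!: sum.cong two(2) g' simp del: atLeastAtMost_iff intro: ints)
    then show ?thesis
      by (subst Bochner_Integration.integral_sum) (auto intro!: sum.cong inner simp del: atLeastAtMost_iff)
  qed
  also have "\<dots> = (\<Sum>\<tau>=0..D. (\<sigma> \<tau>)\<^sup>2 * (LINT p|M. g \<tau> p \<bullet> (Z *v g \<tau> p)))"
  proof (intro sum.cong refl)
    fix \<tau> assume "\<tau> \<in> {0..D}"
    moreover have "(\<Sum>\<rho>=0..D. (\<sigma> \<tau>)\<^sup>2 * of_bool (\<tau> = \<rho>) * (LINT p|M. g \<tau> p \<bullet> (Z *v g \<rho> p)))
        = (\<Sum>\<rho>=0..D. if \<tau> = \<rho> then (\<sigma> \<tau>)\<^sup>2 * (LINT p|M. g \<tau> p \<bullet> (Z *v g \<rho> p)) else 0)"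
      by (intro sum.cong) auto
    ultimately show "(\<Sum>\<rho>=0..D. (\<sigma> \<tau>)\<^sup>2 * of_bool (\<tau> = \<rho>) * (LINT p|M. g \<tau> p \<bullet> (Z *v g \<rho> p)))
        = (\<sigma> \<tau>)\<^sup>2 * (LINT p|M. g \<tau> p \<bullet> (Z *v g \<tau> p))"
      by simp
  qed
  finally have pairs: "(LINT p|M. (\<Sum>\<tau>=0..D. \<Sum>\<rho>=0..D. \<omega> \<tau> t p * \<omega> \<rho> t p * (g \<tau> p \<bullet> (Z *v g \<rho> p))))
      = (\<Sum>\<tau>=0..D. (\<sigma> \<tau>)\<^sup>2 * (LINT p|M. g \<tau> p \<bullet> (Z *v g \<tau> p)))" .
  show ?thesis
    unfolding *
    apply (subst Bochner_Integration.integral_add)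
    apply (intro Bochner_Integration.integrable_add Bochner_Integration.integrable_sum ints; assumption)+
    apply (subst Bochner_Integration.integral_add)
    apply (intro Bochner_Integration.integrable_add Bochner_Integration.integrable_sum ints; assumption)+
    apply (subst Bochner_Integration.integral_add)
    apply (intro Bochner_Integration.integrable_add Bochner_Integration.integrable_sum ints; assumption)+
    by (simp add: pairs Bochner_Integration.integral_sum ints one(2) a g')
qed

text \<open>Convergence to zero in mean square, with measurability included so that the notion is stable
  under the operations below.\<close>
definition ms_null :: "(nat \<Rightarrow> 'w \<Rightarrow> real^'k) \<Rightarrow> bool" where
  "ms_null f \<longleftrightarrow> (\<forall>t. L2_past t (f t)) \<and> (\<lambda>t. LINT p|M. f t p \<bullet> f t p) \<longlonglongrightarrow> 0"

lemma ms_null_add: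
  assumes "ms_null f" "ms_null g" shows "ms_null (\<lambda>t p. f t p + g t p)"
proof -
  have L2: "L2_past t (f t)" "L2_past t (g t)" for t
    using assms by (auto simp: ms_null_def)
  have "(LINT p|M. (f t p + g t p) \<bullet> (f t p + g t p))
      \<le> 2 * (LINT p|M. f t p \<bullet> f t p) + 2 * (LINT p|M. g t p \<bullet> g t p)" for t
  proof -
    have "(LINT p|M. (f t p + g t p) \<bullet> (f t p + g t p))
        \<le> (LINT p|M. 2 * (f t p \<bullet> f t p) + 2 * (g t p \<bullet> g t p))"
    proof (intro integral_mono)
      show "(f t p + g t p) \<bullet> (f t p + g t p) \<le> 2 * (f t p \<bullet> f t p) + 2 * (g t p \<bullet> g t p)" for p
        using inner_ge_zero[of "f t p - g t p"] inner_commute[of "f t p" "g t p"]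
        by (simp add: inner_left_distrib inner_right_distrib inner_diff_left inner_diff_right)
    qed (auto intro!: L2_past_inner[of t] L2_past_add L2)
    then show ?thesis by (simp add: L2_past_inner[of t] L2)
  qed
  moreover have "(\<lambda>t. 2 * (LINT p|M. f t p \<bullet> f t p) + 2 * (LINT p|M. g t p \<bullet> g t p)) \<longlonglongrightarrow> 0"
    using assms unfolding ms_null_def by (auto intro!: tendsto_eq_intros)
  moreover have "0 \<le> (LINT p|M. (f t p + g t p) \<bullet> (f t p + g t p))" for t
    by (simp add: Bochner_Integration.integral_nonneg)
  ultimately have "(\<lambda>t. LINT p|M. (f t p + g t p) \<bullet> (f t p + g t p)) \<longlonglongrightarrow> 0"
    by - (rule tendsto_sandwich[OF always_eventually always_eventually tendsto_const]; blast)
  then show ?thesis using L2 by (simp add: ms_null_def L2_past_add)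
qed

lemma ms_null_quadratic:
  assumes "ms_null f"
  shows "(\<lambda>t. LINT p|M. f t p \<bullet> (X *v f t p)) \<longlonglongrightarrow> 0"
proof (rule Lim_null_comparison)
  define c where "c = onorm (\<lambda>v. X *v v)"
  have L2: "L2_past t (f t)" for t
    using assms by (auto simp: ms_null_def)
  have "norm (LINT p|M. f t p \<bullet> (X *v f t p)) \<le> c * (LINT p|M. f t p \<bullet> f t p)" for t
  proof -
    have "\<bar>v \<bullet> (X *v v)\<bar> \<le> c * (v \<bullet> v)" for v
    proof -
      have "\<bar>v \<bullet> (X *v v)\<bar> \<le> norm v * norm (X *v v)" by (rule Cauchy_Schwarz_ineq2)
      also have "\<dots> \<le> norm v * (c * norm v)"
        unfolding c_def by (intro mult_left_mono onorm matrix_vector_mul_bounded_linear) auto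
      finally show ?thesis by (simp add: power2_eq_square algebra_simps flip: power2_norm_eq_inner)
    qed
    then have "(LINT p|M. \<bar>f t p \<bullet> (X *v f t p)\<bar>) \<le> (LINT p|M. c * (f t p \<bullet> f t p))"
      by (intro integral_mono integrable_abs integrable_mult_right integrable_quadratic[of t]
          L2_past_inner[of t] L2) auto
    then show ?thesis
      using order_trans[OF integral_abs_bound[of M "\<lambda>p. f t p \<bullet> (X *v f t p)"]] by simp
  qed
  then show "\<forall>\<^sub>F t in sequentially. norm (LINT p|M. f t p \<bullet> (X *v f t p)) \<le> c * (LINT p|M. f t p \<bullet> f t p)"
    by (intro always_eventually allI)
  show "(\<lambda>t. c * (LINT p|M. f t p \<bullet> f t p)) \<longlonglongrightarrow> 0"
    using assms by (auto simp: ms_null_def intro!: tendsto_mult_right_zero)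
qed

lemma ms_null_matrix:
  fixes X :: "real^'a^'b"
  assumes "ms_null f" shows "ms_null (\<lambda>t p. X *v f t p)"
  using assms ms_null_quadratic[OF assms, of "transpose X ** X"]
  by (simp add: ms_null_def L2_past_matrix inner_matrix_vector_left matrix_vector_mul_assoc
      del: transpose_matrix_vector)

lemma ms_null_sum: "(\<And>i. i \<in> I \<Longrightarrow> ms_null (f i)) \<Longrightarrow> ms_null (\<lambda>t p. \<Sum>i\<in>I. f i t p)"
proof (induction I rule: infinite_finite_induct)
  case (insert i I)
  then show ?case by (simp add: ms_null_add)
qed (auto simp: ms_null_def L2_past_const)

end

section \<open>The predictor and its energy\<close>

locale delay_control = delay_noise M D \<sigma> \<omega> + delay_lq D A B C \<sigma> R Q
  for M :: "'w measure" and D and \<sigma> and \<omega> :: "nat \<Rightarrow> nat \<Rightarrow> 'w \<Rightarrow> real"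
    and A :: "real^'n^'n" and B C :: "nat \<Rightarrow> real^'m^'n" and R Q +
  assumes invertible_A: "invertible A"
begin

text \<open>The matrix with which the control applied \<open>k\<close> steps ago enters the predictor. For
  \<open>1 \<le> k \<le> j \<le> D\<close> the exponent is a genuine difference of natural numbers.\<close>
definition input_weight :: "nat \<Rightarrow> real^'m^'n" where
  "input_weight k = (\<Sum>j=k..D. mat_pow A (D + k - 1 - j) ** B j)"

text \<open>The state of the noise-free system \<open>D\<close> steps ahead if no further control is applied.\<close>
definition predict :: "real^'n \<Rightarrow> (nat \<Rightarrow> real^'m) \<Rightarrow> real^'n" where
  "predict y v = mat_pow A D *v y + (\<Sum>k=1..D. input_weight k *v v k)"

lemma A_predict:
  "A *v predict y v = mat_pow A D *v (A *v y)
    + (\<Sum>k=1..D. (\<Sum>j=k..D. mat_pow A (D + k - j) ** B j) *v v k)"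
proof -
  have "A ** input_weight k = (\<Sum>j=k..D. mat_pow A (D + k - j) ** B j)" if "k \<in> {1..D}" for k
  proof -
    have "A ** input_weight k *v v = (\<Sum>j=k..D. mat_pow A (D + k - j) ** B j) *v v" for v
    proof -
      have "A *v (mat_pow A (D + k - 1 - j) ** B j *v v) = mat_pow A (D + k - j) ** B j *v v"
        if "j \<in> {k..D}" for j
      proof -
        have "D + k - j = Suc (D + k - 1 - j)" using that \<open>k \<in> {1..D}\<close> by auto
        then show ?thesis by (simp add: matrix_vector_mul_assoc matrix_mul_assoc)
      qed
      then show ?thesis
        unfolding matrix_vector_mul_assoc[symmetric, of A] input_weight_def
          sum_matrix_vector_mult matrix_vector_mult_sum by (intro sum.cong) auto
    qed
    then show ?thesis by (subst matrix_eq) blast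
  qed
  then show ?thesis
    unfolding predict_def
    by (simp add: matrix_vector_right_distrib matrix_vector_mult_sum matrix_vector_mul_assoc
        mat_pow_commute)
qed

text \<open>In terms of the predictor the policy is an undelayed linear feedback; the delayed terms of the
  policy only serve to form the predictor.\<close>
lemma riccati_policy_eq_predict:
  "riccati_policy D A B C \<sigma> R Q Z y v = - (gain Z *v predict y v)"
proof -
  have "mat_pow A D *v (\<Sum>k=1..D. \<Sum>j=k..D. (mat_powi A (int k - int j) ** B j) *v v k)
      = (\<Sum>k=1..D. (\<Sum>j=k..D. mat_pow A (D + k - j) ** B j) *v v k)"
    unfolding sum_matrix_vector_mult matrix_vector_mult_sum
    by (intro sum.cong refl)
      (simp add: matrix_vector_mul_assoc matrix_mul_assoc mat_pow_mult_powi[OF invertible_A])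
  then have "mat_pow A D *v (A *v y
        + (\<Sum>k=1..D. \<Sum>j=k..D. (mat_powi A (int k - int j) ** B j) *v v k)) = A *v predict y v"
    unfolding A_predict matrix_vector_right_distrib by simp
  then show ?thesis
    unfolding riccati_policy_def gain_def matrix_vector_mul_assoc[symmetric] by simp
qed

lemma riccati_policy_is_gain_policy:
  "riccati_policy D A B C \<sigma> R Q Z
    = gain_policy D (- (gain Z ** mat_pow A D)) (\<lambda>k. - (gain Z ** input_weight k))"
proof (intro ext)
  have neg: "(- X) *v w = - (X *v w)" for X :: "real^'a^'b" and w
    using matrix_vector_mult_diff_rdistrib[of 0 X w] by simp
  show "riccati_policy D A B C \<sigma> R Q Z y v
      = gain_policy D (- (gain Z ** mat_pow A D)) (\<lambda>k. - (gain Z ** input_weight k)) y v" for y v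
    unfolding riccati_policy_eq_predict gain_policy_def predict_def
    by (simp add: neg matrix_vector_right_distrib matrix_vector_mult_sum
        matrix_vector_mul_assoc sum_negf)
qed

end

lemma gain_policy_cong:
  "(\<And>\<tau>. 1 \<le> \<tau> \<Longrightarrow> \<tau> \<le> D \<Longrightarrow> v \<tau> = v' \<tau>) \<Longrightarrow> gain_policy D K\<^sub>0 K y v = gain_policy D K\<^sub>0 K y v'"
  unfolding gain_policy_def by (intro arg_cong2[where f="(+)"] sum.cong) auto

locale closed_loop = delay_control M D \<sigma> \<omega> A B C R Q
  for M :: "'w measure" and D and \<sigma> and \<omega> :: "nat \<Rightarrow> nat \<Rightarrow> 'w \<Rightarrow> real"
    and A :: "real^'n^'n" and B C :: "nat \<Rightarrow> real^'m^'n" and R Q +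
  fixes x0 :: "real^'n" and \<phi> :: "int \<Rightarrow> real^'m"
    and x :: "nat \<Rightarrow> 'w \<Rightarrow> real^'n" and u :: "int \<Rightarrow> 'w \<Rightarrow> real^'m"
    and K\<^sub>0 :: "real^'n^'m" and K :: "nat \<Rightarrow> real^'m^'m"
  assumes trajectory: "system_trajectory M D A B C \<omega> x0 \<phi> x u"
    and follows: "follows_policy M (gain_policy D K\<^sub>0 K) x u"
begin

definition predictor :: "nat \<Rightarrow> 'w \<Rightarrow> real^'n" where
  "predictor t p = predict (x t p) (\<lambda>k. u (int t - int k) p)"

text \<open>In \<open>A\<^sup>D x\<^sub>t\<^sub>+\<^sub>1\<close> the control \<open>u\<^sub>t\<^sub>-\<^sub>k\<close> has weight \<open>A\<^sup>D B\<^sub>k\<close>, precisely the summand that is missing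
  in its weight after the shift of the window, \<open>input_weight (k + 1)\<close>. Together they give the weight
  that \<open>u\<^sub>t\<^sub>-\<^sub>k\<close> has in \<open>A y\<^sub>t\<close>, or \<open>L\<close> for \<open>k = 0\<close>.\<close>
lemma predictor_Suc:
  assumes p: "p \<in> space M"
  shows "predictor (Suc t) p = (A *v predictor t p + L *v u (int t) p)
    + (\<Sum>\<tau>=0..D. \<omega> \<tau> t p *\<^sub>R (G \<tau> *v u (int t - int \<tau>) p))"
proof -
  let ?u = "\<lambda>k. u (int t - int k) p"
  let ?N = "\<lambda>k. \<Sum>j=k..D. mat_pow A (D + k - j) ** B j"
  have x: "x (Suc t) p = A *v x t p + (\<Sum>k=0..D. B k *v ?u k) + (\<Sum>k=0..D. \<omega> k t p *\<^sub>R (C k *v ?u k))"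
    using trajectory p
    by (simp add: system_trajectory_def matrix_vector_mult_add_rdistrib sum.distrib
        scaleR_matrix_vector_assoc)
  have "(\<Sum>k=1..D. input_weight k *v u (int (Suc t) - int k) p)
      = (\<Sum>k\<in>{0..<D}. input_weight (Suc k) *v ?u k)"
    by (rule sum.reindex_bij_witness[of _ Suc "\<lambda>k. k - 1"]) (auto simp: algebra_simps of_nat_diff)
  \<comment> \<open>The added summand \<open>k = D\<close> is zero, as \<open>input_weight (D + 1)\<close> is an empty sum.\<close>
  also have "\<dots> = (\<Sum>k=0..D. input_weight (Suc k) *v ?u k)"
    by (rule sum.mono_neutral_left) (auto simp: input_weight_def)
  also have "(\<Sum>k=0..D. (mat_pow A D ** B k) *v ?u k) + \<dots> = (\<Sum>k=0..D. ?N k *v ?u k)"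
  proof -
    have "mat_pow A D ** B k + input_weight (Suc k) = ?N k" if "k \<in> {0..D}" for k
      using that by (simp add: input_weight_def sum.atLeast_Suc_atMost)
    then show ?thesis
      unfolding sum.distrib[symmetric] matrix_vector_mult_add_rdistrib[symmetric] by simp
  qed
  also have "\<dots> = L *v u (int t) p + (\<Sum>k=1..D. ?N k *v ?u k)"
    by (simp add: sum.atLeast_Suc_atMost[of 0] L_mat_def)
  finally have "(\<Sum>k=0..D. (mat_pow A D ** B k) *v ?u k)
      + (\<Sum>k=1..D. input_weight k *v u (int (Suc t) - int k) p)
      = L *v u (int t) p + (\<Sum>k=1..D. ?N k *v ?u k)" .
  moreover have "mat_pow A D *v x (Suc t) p = mat_pow A D *v (A *v x t p)
      + (\<Sum>k=0..D. (mat_pow A D ** B k) *v ?u k) + (\<Sum>k=0..D. \<omega> k t p *\<^sub>R (G k *v ?u k))"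
    by (simp add: x matrix_vector_right_distrib matrix_vector_mult_sum matrix_vector_mul_assoc
        matrix_vector_mult_scaleR)
  ultimately show ?thesis
    unfolding predictor_def A_predict by (simp add: predict_def algebra_simps)
qed

lemma L2_past_trajectory: "L2_past t (x t) \<and> (\<forall>s. - int D \<le> s \<and> s < int t \<longrightarrow> L2_past t (u s))"
  and L2_past_control_now: "L2_past t (u (int t))"
proof -
  have now: "L2_past t (u (int t))"
    if "L2_past t (x t) \<and> (\<forall>s. - int D \<le> s \<and> s < int t \<longrightarrow> L2_past t (u s))" for t
  proof -
    have "L2_past t (\<lambda>p. gain_policy D K\<^sub>0 K (x t p) (\<lambda>\<tau>. u (int t - int \<tau>) p))"
      unfolding gain_policy_def using that
      by (intro L2_past_add L2_past_sum L2_past_matrix) auto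
    then show ?thesis
      using follows by (subst L2_past_cong) (auto simp: follows_policy_def)
  qed
  have main: "L2_past t (x t) \<and> (\<forall>s. - int D \<le> s \<and> s < int t \<longrightarrow> L2_past t (u s))" for t
  proof (induction t)
    case 0
    have "L2_past 0 (x 0) \<longleftrightarrow> L2_past 0 (\<lambda>_. x0)"
      using trajectory by (intro L2_past_cong) (auto simp: system_trajectory_def)
    then have "L2_past 0 (x 0)"
      using L2_past_const by blast
    moreover have "L2_past 0 (u s)" if "- int D \<le> s \<and> s < int 0" for s
    proof -
      have "L2_past 0 (u s) \<longleftrightarrow> L2_past 0 (\<lambda>_. \<phi> s)"
        using trajectory that by (intro L2_past_cong) (auto simp: system_trajectory_def)
      then show ?thesis using L2_past_const by blast
    qed
    ultimately show ?case by blast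
  next
    case (Suc t)
    have u: "L2_past t (u s)" if "- int D \<le> s" "s \<le> int t" for s
      using Suc now[OF Suc] that by (cases "s = int t") auto
    have "L2_past (Suc t) (\<lambda>p. A *v x t p + (\<Sum>k=0..D. B k *v u (int t - int k) p)
        + (\<Sum>k=0..D. C k *v (\<omega> k t p *\<^sub>R u (int t - int k) p)))"
      using u Suc
      by (intro L2_past_add L2_past_sum L2_past_matrix L2_past_noise)
        (auto intro: L2_past_mono[of t])
    moreover have "x (Suc t) p = A *v x t p + (\<Sum>k=0..D. B k *v u (int t - int k) p)
        + (\<Sum>k=0..D. C k *v (\<omega> k t p *\<^sub>R u (int t - int k) p))" if "p \<in> space M" for p
      using trajectory that
      by (simp add: system_trajectory_def matrix_vector_mult_add_rdistrib sum.distrib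
          matrix_vector_mult_scaleR scaleR_matrix_vector_assoc)
    ultimately have "L2_past (Suc t) (x (Suc t))"
      by (subst L2_past_cong) auto
    moreover have "L2_past (Suc t) (u s)" if "- int D \<le> s \<and> s < int (Suc t)" for s
      using u[of s] that by (auto intro: L2_past_mono[of t])
    ultimately show ?case by blast
  qed
  show "L2_past t (x t) \<and> (\<forall>s. - int D \<le> s \<and> s < int t \<longrightarrow> L2_past t (u s))" by (rule main)
  show "L2_past t (u (int t))" by (rule now[OF main])
qed

lemma L2_past_state: "L2_past t (x t)"
  using L2_past_trajectory by blast

lemma L2_past_control: "- int D \<le> s \<Longrightarrow> s \<le> int t \<Longrightarrow> L2_past t (u s)"
  using L2_past_trajectory[of t] L2_past_control_now[of t] by (cases "s = int t") auto

lemma L2_past_predictor: "L2_past t (predictor t)"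
  unfolding predictor_def[abs_def] predict_def
  by (intro L2_past_add L2_past_sum L2_past_matrix L2_past_state L2_past_control) auto

text \<open>The contribution to the \<open>Z\<close>-energy of the control at time \<open>s\<close> through channel \<open>\<tau>\<close>, which
  reaches the predictor at time \<open>s + \<tau> + 1\<close>.\<close>
definition pending :: "real^'n^'n \<Rightarrow> nat \<Rightarrow> int \<Rightarrow> real" where
  "pending Z \<tau> s = (\<sigma> \<tau>)\<^sup>2 * (LINT p|M. (G \<tau> *v u s p) \<bullet> (Z *v (G \<tau> *v u s p)))"

text \<open>The second sum runs over the controls applied before \<open>t\<close> whose noise in channel \<open>\<tau>\<close> has not yet
  arrived at time \<open>t\<close>.\<close>
definition energy :: "real^'n^'n \<Rightarrow> nat \<Rightarrow> real" where
  "energy Z t = (LINT p|M. predictor t p \<bullet> (Z *v predictor t p))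
     + (\<Sum>\<tau>=1..D. \<Sum>k=1..\<tau>. pending Z \<tau> (int t - int k))"

definition cost :: "nat \<Rightarrow> real" where
  "cost t = (LINT p|M. stage_cost (predictor t p) (u (int t) p))"

lemma integrable_noise_energy: "integrable M (\<lambda>p. noise_energy Z (u (int t) p))"
  unfolding noise_energy_def
  by (intro Bochner_Integration.integrable_sum integrable_mult_right integrable_quadratic[of t]
      L2_past_matrix L2_past_control_now)

lemma integrable_stage_cost: "integrable M (\<lambda>p. stage_cost (predictor t p) (u (int t) p))"
  unfolding stage_cost_def
  by (intro Bochner_Integration.integrable_add integrable_quadratic[of t] L2_past_predictor
      L2_past_control_now)

text \<open>In each channel the contribution of \<open>u\<^sub>t\<^sub>-\<^sub>\<tau>\<close> moves from the pending part into the quadratic form of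
  the new predictor, and that of \<open>u\<^sub>t\<close> becomes pending. The net effect is that of undelayed noise, whose
  value \<open>lookahead\<close> describes.\<close>
lemma energy_step:
  "energy Z (Suc t) - energy Z t
    = (LINT p|M. lookahead Z (predictor t p) (u (int t) p))
      - (LINT p|M. predictor t p \<bullet> (Z *v predictor t p)) - cost t"
proof -
  let ?a = "\<lambda>p. A *v predictor t p + L *v u (int t) p"
  have a: "L2_past t ?a"
    by (intro L2_past_add L2_past_matrix L2_past_predictor L2_past_control_now)
  have "(LINT p|M. predictor (Suc t) p \<bullet> (Z *v predictor (Suc t) p))
      = (LINT p|M. ?a p \<bullet> (Z *v ?a p)) + (\<Sum>\<tau>=0..D. pending Z \<tau> (int t - int \<tau>))"
    unfolding pending_def
    by (subst expectation_noisy_quadratic[symmetric, OF a])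
      (auto intro!: L2_past_matrix L2_past_control Bochner_Integration.integral_cong
        simp: predictor_Suc)
  moreover have "(\<Sum>k=1..m. f (int (Suc t) - int k))
      = (\<Sum>k=1..m. f (int t - int k)) + f (int t) - f (int t - int m)" for m and f :: "int \<Rightarrow> real"
    by (induction m) auto
  then have "(\<Sum>\<tau>=1..D. \<Sum>k=1..\<tau>. pending Z \<tau> (int (Suc t) - int k))
      = (\<Sum>\<tau>=1..D. \<Sum>k=1..\<tau>. pending Z \<tau> (int t - int k))
        + (\<Sum>\<tau>=0..D. pending Z \<tau> (int t)) - (\<Sum>\<tau>=0..D. pending Z \<tau> (int t - int \<tau>))"
    by (simp add: sum.distrib sum_subtractf sum.atLeast_Suc_atMost[of 0])
  moreover have "(\<Sum>\<tau>=0..D. pending Z \<tau> (int t)) = (LINT p|M. noise_energy Z (u (int t) p))"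
    unfolding pending_def noise_energy_def
    by (subst Bochner_Integration.integral_sum)
      (auto intro!: integrable_mult_right integrable_quadratic[of t] L2_past_matrix L2_past_control_now)
  moreover have "(LINT p|M. lookahead Z (predictor t p) (u (int t) p))
      = (LINT p|M. ?a p \<bullet> (Z *v ?a p)) + (LINT p|M. noise_energy Z (u (int t) p)) + cost t"
  proof -
    have "integrable M (\<lambda>p. ?a p \<bullet> (Z *v ?a p))"
      using a by (rule integrable_quadratic[OF _ a])
    then show ?thesis
      unfolding lookahead_def cost_def
      by (simp add: integrable_noise_energy integrable_stage_cost)
  qed
  ultimately show ?thesis
    unfolding energy_def by linarith
qed

lemma energy_step_riccati:
  assumes "psd Z"
  shows "energy Z (Suc t) - energy Z t
    = (LINT p|M. predictor t p \<bullet> (riccati_map Z *v predictor t p))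
      - (LINT p|M. predictor t p \<bullet> (Z *v predictor t p))
      + (LINT p|M. (u (int t) p + gain Z *v predictor t p)
           \<bullet> (\<Psi> Z *v (u (int t) p + gain Z *v predictor t p))) - cost t"
proof -
  have "L2_past t (\<lambda>p. u (int t) p + gain Z *v predictor t p)"
    by (intro L2_past_add L2_past_matrix L2_past_predictor L2_past_control_now)
  then show ?thesis
    unfolding energy_step completion_of_squares[OF assms]
    by (subst Bochner_Integration.integral_add)
      (auto intro: integrable_quadratic L2_past_predictor)
qed

text \<open>For a subsolution both terms besides the cost in the one-step identity are nonnegative.\<close>
lemma energy_le_subsolution:
  assumes Z: "psd Z" and sub: "\<And>v. v \<bullet> (Z *v v) \<le> v \<bullet> (riccati_map Z *v v)"
  shows "energy Z 0 \<le> energy Z t + (\<Sum>s<t. cost s)"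
proof (induction t)
  case (Suc t)
  have "(LINT p|M. predictor t p \<bullet> (Z *v predictor t p))
      \<le> (LINT p|M. predictor t p \<bullet> (riccati_map Z *v predictor t p))"
    by (intro integral_mono integrable_quadratic[of t] L2_past_predictor sub)
  moreover have "0 \<le> (LINT p|M. (u (int t) p + gain Z *v predictor t p)
           \<bullet> (\<Psi> Z *v (u (int t) p + gain Z *v predictor t p)))"
    by (intro Bochner_Integration.integral_nonneg psd_nonneg pos_def_imp_psd pos_def_Psi Z)
  ultimately show ?case using Suc energy_step_riccati[OF Z, of t] by simp
qed simp

text \<open>For a solution and its own feedback both terms besides the cost vanish.\<close>
lemma energy_eq_optimal:
  assumes Z: "psd Z" "riccati_map Z = Z"
    and opt: "\<And>t p. p \<in> space M \<Longrightarrow> u (int t) p = - (gain Z *v predictor t p)"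
  shows "energy Z 0 = energy Z t + (\<Sum>s<t. cost s)"
proof (induction t)
  case (Suc t)
  have "(LINT p|M. (u (int t) p + gain Z *v predictor t p)
           \<bullet> (\<Psi> Z *v (u (int t) p + gain Z *v predictor t p))) = (LINT p|M. 0)"
    by (intro Bochner_Integration.integral_cong) (auto simp: opt)
  then show ?case using Suc energy_step_riccati[OF Z(1), of t] Z(2) by simp
qed simp

lemma energy_nonneg: "psd Z \<Longrightarrow> 0 \<le> energy Z t"
  unfolding energy_def pending_def
  by (intro add_nonneg_nonneg sum_nonneg mult_nonneg_nonneg Bochner_Integration.integral_nonneg
      psd_nonneg) auto

lemma cost_nonneg: "0 \<le> cost t"
  unfolding cost_def by (intro Bochner_Integration.integral_nonneg stage_cost_nonneg)

text \<open>All subsolutions are measured against the single matrix \<open>mat 1\<close>, so that one time horizon serves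
  all of them.\<close>
lemma energy_le_trace:
  assumes Z: "psd Z"
  shows "energy Z t \<le> trace Z * (real CARD('n)^2 * energy (mat 1) t)"
proof -
  let ?c = "real CARD('n)^2 * trace Z"
  have quad: "(LINT p|M. f p \<bullet> (Z *v f p)) \<le> ?c * (LINT p|M. f p \<bullet> (mat 1 *v f p))"
    if "L2_past t f" for f
  proof -
    have "(LINT p|M. f p \<bullet> (Z *v f p)) \<le> (LINT p|M. ?c * (f p \<bullet> (mat 1 *v f p)))"
      using psd_quad_le_trace[OF Z]
      by (intro integral_mono integrable_mult_right integrable_quadratic[OF that that]) simp
    then show ?thesis by simp
  qed
  have "pending Z \<tau> (int t - int k) \<le> ?c * pending (mat 1) \<tau> (int t - int k)"
    if "\<tau> \<in> {1..D}" "k \<in> {1..\<tau>}" for \<tau> k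
    using mult_left_mono[OF quad[of "\<lambda>p. G \<tau> *v u (int t - int k) p"], of "(\<sigma> \<tau>)\<^sup>2"] that
    by (simp add: pending_def L2_past_matrix L2_past_control mult.left_commute)
  then have "(\<Sum>\<tau>=1..D. \<Sum>k=1..\<tau>. pending Z \<tau> (int t - int k))
      \<le> ?c * (\<Sum>\<tau>=1..D. \<Sum>k=1..\<tau>. pending (mat 1) \<tau> (int t - int k))"
    unfolding sum_distrib_left by (intro sum_mono)
  then show ?thesis
    using quad[OF L2_past_predictor] unfolding energy_def by (simp add: algebra_simps)
qed

lemma ms_null_delay:
  assumes "ms_null (\<lambda>t. u (int t))" "k \<le> D"
  shows "ms_null (\<lambda>t. u (int t - int k))"
  unfolding ms_null_def
proof
  show "\<forall>t. L2_past t (u (int t - int k))"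
    using assms(2) by (intro allI L2_past_control) auto
  have "(\<lambda>t. LINT p|M. u (int (t + k) - int k) p \<bullet> u (int (t + k) - int k) p) \<longlonglongrightarrow> 0"
    using assms(1) by (simp add: ms_null_def)
  then show "(\<lambda>t. LINT p|M. u (int t - int k) p \<bullet> u (int t - int k) p) \<longlonglongrightarrow> 0"
    by (rule LIMSEQ_offset)
qed

text \<open>The predictor is a fixed linear combination of the state and of finitely many past controls.\<close>
lemma ms_null_predictor:
  assumes "ms_null x" "ms_null (\<lambda>t. u (int t))"
  shows "ms_null predictor"
  unfolding predictor_def[abs_def] predict_def
  by (intro ms_null_add ms_null_sum ms_null_matrix ms_null_delay assms) auto

lemma energy_tendsto_0:
  assumes "ms_null predictor" "ms_null (\<lambda>t. u (int t))"
  shows "energy Z \<longlonglongrightarrow> 0"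
proof -
  have "(\<lambda>t. pending Z \<tau> (int t - int k)) \<longlonglongrightarrow> 0" if "\<tau> \<in> {1..D}" "k \<in> {1..\<tau>}" for \<tau> k
    unfolding pending_def using that
    by (intro tendsto_mult_right_zero ms_null_quadratic ms_null_matrix ms_null_delay assms) auto
  then have "(\<lambda>t. energy Z t) \<longlonglongrightarrow> 0 + (\<Sum>\<tau>=1..D. \<Sum>k=1..\<tau>. 0)"
    unfolding energy_def using ms_null_quadratic[OF assms(1)]
    by (intro tendsto_add tendsto_sum)
  then show ?thesis by simp
qed

text \<open>The costs add up to at most the initial energy, and the stage cost is coercive, so \<open>y\<^sub>t\<close> and
  \<open>u\<^sub>t\<close> have summable second moments. The state is recovered from the predictor and the past controls
  by inverting \<open>A\<^sup>D\<close>.\<close>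
lemma optimal_ms_null:
  assumes Z: "psd Z" "riccati_map Z = Z"
    and opt: "\<And>t p. p \<in> space M \<Longrightarrow> u (int t) p = - (gain Z *v predictor t p)"
  shows "summable (\<lambda>t. LINT p|M. u (int t) p \<bullet> u (int t) p)"
    and "ms_null predictor" and "ms_null (\<lambda>t. u (int t))" and "ms_null x"
proof -
  obtain c where c: "c > 0" "\<And>y v. c * (y \<bullet> y + v \<bullet> v) \<le> stage_cost y v"
    using stage_cost_coercive by blast
  have "summable cost"
  proof (rule summableI_nonneg_bounded[OF cost_nonneg])
    show "(\<Sum>s<t. cost s) \<le> energy Z 0" for t
      using energy_eq_optimal[OF assms, of t] energy_nonneg[OF Z(1), of t] by simp
  qed
  then have sc: "summable (\<lambda>t. cost t / c)"
    by (rule summable_divide)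
  have le: "(LINT p|M. predictor t p \<bullet> predictor t p) + (LINT p|M. u (int t) p \<bullet> u (int t) p) \<le> cost t / c" for t
  proof -
    have "(LINT p|M. c * (predictor t p \<bullet> predictor t p + u (int t) p \<bullet> u (int t) p)) \<le> cost t"
      unfolding cost_def
      by (intro integral_mono integrable_mult_right Bochner_Integration.integrable_add
          L2_past_inner[of t] L2_past_predictor L2_past_control_now integrable_stage_cost c(2))
    then show ?thesis
      using c(1) L2_past_inner(2)[OF L2_past_predictor L2_past_predictor, of t]
        L2_past_inner(2)[OF L2_past_control_now L2_past_control_now, of t]
      by (simp add: field_simps)
  qed
  have nn: "0 \<le> (LINT p|M. predictor t p \<bullet> predictor t p)" "0 \<le> (LINT p|M. u (int t) p \<bullet> u (int t) p)" for t
    by (auto intro: Bochner_Integration.integral_nonneg)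
  have sy: "summable (\<lambda>t. LINT p|M. predictor t p \<bullet> predictor t p)"
    using le nn by (intro summable_comparison_test'[OF sc, of 0]) (smt (verit) real_norm_def)
  show su: "summable (\<lambda>t. LINT p|M. u (int t) p \<bullet> u (int t) p)"
    using le nn by (intro summable_comparison_test'[OF sc, of 0]) (smt (verit) real_norm_def)
  show y: "ms_null predictor" and u: "ms_null (\<lambda>t. u (int t))"
    using summable_LIMSEQ_zero[OF sy] summable_LIMSEQ_zero[OF su]
    by (auto simp: ms_null_def L2_past_predictor L2_past_control_now)
  have state: "x = (\<lambda>t p. matrix_inv (mat_pow A D) *v (predictor t p
      + (\<Sum>k=1..D. (- input_weight k) *v u (int t - int k) p)))"
    using matrix_inv_mult_vector(2)[OF invertible_mat_pow[OF invertible_A], of D]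
      matrix_vector_mult_diff_rdistrib[of 0 "input_weight _"]
    by (intro ext) (simp add: predictor_def predict_def sum_negf)
  show "ms_null x"
    by (subst state) (intro ms_null_matrix ms_null_add ms_null_sum ms_null_delay u y, auto)
qed

end

section \<open>Stabilization and solvability\<close>

context delay_control
begin

lemma closed_loopI:
  assumes "system_trajectory M D A B C \<omega> x0 \<phi> x u" "follows_policy M (gain_policy D K\<^sub>0 K) x u"
  shows "closed_loop M D \<sigma> \<omega> A B C R Q x0 \<phi> x u K\<^sub>0 K"
  using assms by unfold_locales

text \<open>With zero past controls the predictor starts at \<open>A\<^sup>D x\<^sub>0\<close>, which is arbitrary for invertible \<open>A\<close>,
  and nothing is pending, so that the initial energy is the plain quadratic form.\<close>
lemma closed_loop_from_predictor:
  fixes v :: "real^'n"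
  obtains x0 x u where "closed_loop M D \<sigma> \<omega> A B C R Q x0 (\<lambda>_. 0) x u K\<^sub>0 K"
    and "\<And>Z. closed_loop.energy M D \<sigma> A B C x u Z 0 = v \<bullet> (Z *v v)"
proof -
  obtain x0 where x0: "mat_pow A D *v x0 = v"
    using matrix_inv_mult_vector(1)[OF invertible_mat_pow[OF invertible_A]] by blast
  obtain x u where tr: "system_trajectory M D A B C \<omega> x0 (\<lambda>_. 0) x u"
    and fo: "follows_policy M (gain_policy D K\<^sub>0 K) x u"
    using closed_loop_exists[where \<pi> = "gain_policy D K\<^sub>0 K"] gain_policy_cong by blast
  interpret closed_loop M D \<sigma> \<omega> A B C R Q x0 "\<lambda>_. 0" x u K\<^sub>0 K
    using tr fo by (rule closed_loopI)
  have past0: "u (- int k) p = 0" if "p \<in> space M" "1 \<le> k" "k \<le> D" for k p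
    using tr that by (auto simp: system_trajectory_def)
  have "predictor 0 p = v" if "p \<in> space M" for p
  proof -
    have "x 0 p = x0" using tr that by (simp add: system_trajectory_def)
    then show ?thesis using past0[OF that] x0 by (simp add: predictor_def predict_def)
  qed
  moreover have "pending Z \<tau> (- int k) = 0" if "1 \<le> k" "k \<le> D" for Z \<tau> k
  proof -
    have "(LINT p|M. (G \<tau> *v u (- int k) p) \<bullet> (Z *v (G \<tau> *v u (- int k) p))) = (LINT p|M. 0)"
      using past0 that by (intro Bochner_Integration.integral_cong) auto
    then show ?thesis by (simp add: pending_def)
  qed
  ultimately have "energy Z 0 = (LINT p|M. v \<bullet> (Z *v v))" for Z
    unfolding energy_def by (simp cong: Bochner_Integration.integral_cong)
  then have "energy Z 0 = v \<bullet> (Z *v v)" for Z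
    by (simp add: prob_space)
  with closed_loop_axioms show ?thesis by (rule that)
qed

text \<open>Start the stabilized loop from \<open>e\<^sub>i\<close>. The diagonal entry \<open>Z\<^sub>i\<^sub>i\<close> is then the initial energy, which
  is at most the energy at time \<open>T\<close> plus a cost independent of \<open>Z\<close>. For large \<open>T\<close> the former is at
  most \<open>1 / (2 n)\<close> times the trace; summing the \<open>n\<close> entries leaves half of the trace on the right, to be
  absorbed on the left.\<close>
lemma stabilizing_trace_bound:
  assumes stab: "stabilizing_policy M D A B C \<omega> (gain_policy D K\<^sub>0 K)"
  shows "\<exists>b. \<forall>Z. psd Z \<longrightarrow> (\<forall>v. v \<bullet> (Z *v v) \<le> v \<bullet> (riccati_map Z *v v)) \<longrightarrow> trace Z \<le> b"
proof -
  have "\<exists>c. \<forall>Z. psd Z \<longrightarrow> (\<forall>v. v \<bullet> (Z *v v) \<le> v \<bullet> (riccati_map Z *v v))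
      \<longrightarrow> Z $ i $ i \<le> trace Z / (2 * real CARD('n)) + c" for i
  proof -
    obtain x0 x u where cl: "closed_loop M D \<sigma> \<omega> A B C R Q x0 (\<lambda>_. 0) x u K\<^sub>0 K"
      and start: "\<And>Z. closed_loop.energy M D \<sigma> A B C x u Z 0 = axis i 1 \<bullet> (Z *v axis i 1)"
      using closed_loop_from_predictor[of K\<^sub>0 K "axis i 1"] by metis
    interpret closed_loop M D \<sigma> \<omega> A B C R Q x0 "\<lambda>_. 0" x u K\<^sub>0 K
      by (rule cl)
    have "u \<in> admissible_controls M D A B C \<omega> x0 (\<lambda>_. 0)" "(\<lambda>t. LINT p|M. x t p \<bullet> x t p) \<longlonglongrightarrow> 0"
      using stab trajectory follows unfolding stabilizing_policy_def by blast+
    then have x: "ms_null x" and u: "ms_null (\<lambda>t. u (int t))"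
      unfolding admissible_controls_def ms_null_def
      by (auto simp: L2_past_state L2_past_control_now intro: summable_LIMSEQ_zero)
    have "energy (mat 1) \<longlonglongrightarrow> 0"
      by (rule energy_tendsto_0[OF ms_null_predictor[OF x u] u])
    then have "(\<lambda>t. real CARD('n)^2 * energy (mat 1) t) \<longlonglongrightarrow> 0"
      by (rule tendsto_mult_right_zero)
    from order_tendstoD(2)[OF this, of "1 / (2 * real CARD('n))"]
    obtain T where T: "real CARD('n)^2 * energy (mat 1) T < 1 / (2 * real CARD('n))"
      by (auto simp: eventually_sequentially)
    have "Z $ i $ i \<le> trace Z / (2 * real CARD('n)) + (\<Sum>s<T. cost s)"
      if Z: "psd Z" "\<forall>v. v \<bullet> (Z *v v) \<le> v \<bullet> (riccati_map Z *v v)" for Z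
    proof -
      have "Z $ i $ i = energy Z 0"
        by (simp add: start inner_axis' matrix_vector_mult_basis column_def)
      also have "\<dots> \<le> energy Z T + (\<Sum>s<T. cost s)"
        using Z by (intro energy_le_subsolution) auto
      also have "energy Z T \<le> trace Z * (real CARD('n)^2 * energy (mat 1) T)"
        using Z(1) by (rule energy_le_trace)
      also have "\<dots> \<le> trace Z * (1 / (2 * real CARD('n)))"
        using T psd_trace_nonneg[OF Z(1)] by (intro mult_left_mono) auto
      finally show ?thesis by simp
    qed
    then show ?thesis by blast
  qed
  then obtain c where c: "\<And>i Z. psd Z \<Longrightarrow> (\<forall>v. v \<bullet> (Z *v v) \<le> v \<bullet> (riccati_map Z *v v))
      \<Longrightarrow> Z $ i $ i \<le> trace Z / (2 * real CARD('n)) + c i"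
    by metis
  have "trace Z \<le> 2 * (\<Sum>i\<in>UNIV. c i)"
    if "psd Z" "\<forall>v. v \<bullet> (Z *v v) \<le> v \<bullet> (riccati_map Z *v v)" for Z
  proof -
    have "trace Z \<le> (\<Sum>i\<in>(UNIV::'n set). trace Z / (2 * real CARD('n)) + c i)"
      unfolding trace_def[of Z] by (intro sum_mono c[unfolded trace_def] that)
    also have "\<dots> = trace Z / 2 + (\<Sum>i\<in>UNIV. c i)"
      by (simp add: sum.distrib)
    finally show ?thesis by simp
  qed
  then show ?thesis by blast
qed

lemma riccati_policy_stabilizing:
  assumes Z: "psd Z" "riccati_map Z = Z"
  shows "stabilizing_policy M D A B C \<omega> (riccati_policy D A B C \<sigma> R Q Z)"
  unfolding stabilizing_policy_def riccati_policy_is_gain_policy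
proof (intro allI impI)
  let ?F = "- (gain Z ** mat_pow A D)" and ?H = "\<lambda>k. - (gain Z ** input_weight k)"
  fix x0 \<phi> x u
  assume tr: "system_trajectory M D A B C \<omega> x0 \<phi> x u"
    and fo: "follows_policy M (gain_policy D ?F ?H) x u"
  interpret closed_loop M D \<sigma> \<omega> A B C R Q x0 \<phi> x u ?F ?H
    using tr fo by (rule closed_loopI)
  have opt: "u (int t) p = - (gain Z *v predictor t p)" if "p \<in> space M" for t p
    using fo that unfolding follows_policy_def riccati_policy_is_gain_policy[symmetric]
      riccati_policy_eq_predict predictor_def by blast
  note null = optimal_ms_null[OF Z opt]
  have "u (int t) \<in> borel_measurable (noise_filtration M D \<omega> t)" for t
    using L2_past_mono[OF L2_past_control_now, of t "Suc t"]
    by (simp add: noise_filtration_eq_past L2_past_def)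
  moreover have "integrable M (\<lambda>p. u (int t) p \<bullet> u (int t) p)" for t
    using L2_past_control_now by (simp add: L2_past_def)
  ultimately show "u \<in> admissible_controls M D A B C \<omega> x0 \<phi> \<and>
      (\<forall>t. integrable M (\<lambda>p. x t p \<bullet> x t p)) \<and> (\<lambda>t. LINT p|M. x t p \<bullet> x t p) \<longlonglongrightarrow> 0"
    using null(1,4) tr fo unfolding admissible_controls_def ms_null_def L2_past_def by blast
qed

text \<open>Compare both solutions along the closed loop that is optimal for \<open>Z\<close>: its total cost is at most
  \<open>v' Z v\<close>, and the \<open>Y\<close>-energy loses no more than this cost on its way from \<open>v' Y v\<close> to zero.\<close>
lemma riccati_solution_le:
  assumes Z: "psd Z" "riccati_map Z = Z" and Y: "psd Y" "riccati_map Y = Y"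
  shows "v \<bullet> (Y *v v) \<le> v \<bullet> (Z *v v)"
proof -
  let ?F = "- (gain Z ** mat_pow A D)" and ?H = "\<lambda>k. - (gain Z ** input_weight k)"
  obtain x0 x u where cl: "closed_loop M D \<sigma> \<omega> A B C R Q x0 (\<lambda>_. 0) x u ?F ?H"
    and start: "\<And>X. closed_loop.energy M D \<sigma> A B C x u X 0 = v \<bullet> (X *v v)"
    using closed_loop_from_predictor[of ?F ?H v] by metis
  interpret closed_loop M D \<sigma> \<omega> A B C R Q x0 "\<lambda>_. 0" x u ?F ?H
    by (rule cl)
  have opt: "u (int t) p = - (gain Z *v predictor t p)" if "p \<in> space M" for t p
    using follows that unfolding follows_policy_def riccati_policy_is_gain_policy[symmetric]
      riccati_policy_eq_predict predictor_def by blast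
  have "(\<lambda>t. energy Y t + energy Z 0) \<longlonglongrightarrow> 0 + energy Z 0"
    by (intro tendsto_add tendsto_const energy_tendsto_0 optimal_ms_null[OF Z opt])
  moreover have "energy Y 0 \<le> energy Y t + energy Z 0" for t
    using energy_le_subsolution[OF Y(1), of t] energy_eq_optimal[OF Z opt, of t]
      energy_nonneg[OF Z(1), of t] by (simp add: Y(2))
  ultimately have "energy Y 0 \<le> energy Z 0"
    using LIMSEQ_le_const by fastforce
  then show ?thesis by (simp add: start)
qed

lemma riccati_solution_unique:
  assumes "pos_def Y" "riccati_map Y = Y" "pos_def Z" "riccati_map Z = Z"
  shows "Y = Z"
proof (rule symmetric_eqI)
  show "v \<bullet> (Y *v v) = v \<bullet> (Z *v v)" for v
    using riccati_solution_le assms pos_def_imp_psd by (metis antisym)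
qed (use assms in \<open>auto simp: pos_def_def\<close>)

lemma riccati_solvable_if_stabilizable:
  assumes "ms_stabilizable M D A B C \<omega>"
  shows "\<exists>!Z. pos_def Z \<and> riccati_map Z = Z"
proof -
  obtain b where "\<And>Z. psd Z \<Longrightarrow> (\<And>y. y \<bullet> (Z *v y) \<le> y \<bullet> (riccati_map Z *v y)) \<Longrightarrow> trace Z \<le> b"
    using assms stabilizing_trace_bound unfolding ms_stabilizable_def by metis
  then show ?thesis
    using riccati_fixed_point riccati_solution_unique by metis
qed

end

theorem theorem1:
  fixes A :: "real^'n^'n"
    and B C :: "nat \<Rightarrow> real^'m^'n"
    and D :: nat
    and \<sigma> :: "nat \<Rightarrow> real"
    and M :: "'w measure"
    and \<omega> :: "nat \<Rightarrow> nat \<Rightarrow> 'w \<Rightarrow> real"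
  assumes "invertible A"
    and "noise M D \<sigma> \<omega>"
  shows "(ms_stabilizable M D A B C \<omega> \<longleftrightarrow>
           (\<forall>(Q :: real^'n^'n) (R :: real^'m^'m). pos_def Q \<longrightarrow> pos_def R \<longrightarrow>
              (\<exists>!Z. pos_def Z \<and> solves_riccati D A B C \<sigma> R Q Z)))
       \<and> (ms_stabilizable M D A B C \<omega> \<longrightarrow>
           (\<forall>(Q :: real^'n^'n) (R :: real^'m^'m) Z. pos_def Q \<longrightarrow> pos_def R \<longrightarrow> pos_def Z \<longrightarrow>
              solves_riccati D A B C \<sigma> R Q Z \<longrightarrow>
              stabilizing_policy M D A B C \<omega> (riccati_policy D A B C \<sigma> R Q Z)))"
proof -
  have prob: "prob_space M"
    using assms(2) by (simp add: noise_def)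
  have ctrl: "delay_control M D \<sigma> \<omega> A R Q" if "pos_def Q" "pos_def R"
    for Q :: "real^'n^'n" and R :: "real^'m^'m"
    using that assms prob
    by (auto simp: delay_control_def delay_control_axioms_def delay_noise_def delay_noise_axioms_def
        delay_lq_def)
  have policy: "stabilizing_policy M D A B C \<omega> (riccati_policy D A B C \<sigma> R Q Z)"
    if "pos_def Q" "pos_def R" "pos_def Z" "solves_riccati D A B C \<sigma> R Q Z"
    for Q :: "real^'n^'n" and R :: "real^'m^'m" and Z
  proof -
    interpret delay_control M D \<sigma> \<omega> A B C R Q
      using that(1,2) by (rule ctrl)
    show ?thesis
      using that(3,4) by (simp add: riccati_policy_stabilizing pos_def_imp_psd solves_riccati_iff)
  qed
  have solvable: "\<exists>!Z. pos_def Z \<and> solves_riccati D A B C \<sigma> R Q Z"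
    if "ms_stabilizable M D A B C \<omega>" "pos_def Q" "pos_def R"
    for Q :: "real^'n^'n" and R :: "real^'m^'m"
  proof -
    interpret delay_control M D \<sigma> \<omega> A B C R Q
      using that(2,3) by (rule ctrl)
    show ?thesis
      using riccati_solvable_if_stabilizable[OF that(1)] by (simp add: solves_riccati_iff)
  qed
  have stabilizable: "ms_stabilizable M D A B C \<omega>"
    if all: "\<forall>(Q :: real^'n^'n) (R :: real^'m^'m). pos_def Q \<longrightarrow> pos_def R \<longrightarrow>
              (\<exists>!Z. pos_def Z \<and> solves_riccati D A B C \<sigma> R Q Z)"
  proof -
    \<comment> \<open>One choice of weights suffices, as the policy of any solution stabilizes.\<close>
    interpret delay_control M D \<sigma> \<omega> A B C "mat 1" "mat 1"
      by (intro ctrl pos_def_mat_1)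
    obtain Z where "pos_def Z" "solves_riccati D A B C \<sigma> (mat 1) (mat 1) Z"
      using all[rule_format, OF pos_def_mat_1 pos_def_mat_1] by blast
    then have "stabilizing_policy M D A B C \<omega> (riccati_policy D A B C \<sigma> (mat 1) (mat 1) Z)"
      by (rule policy[OF pos_def_mat_1 pos_def_mat_1])
    then show ?thesis
      unfolding ms_stabilizable_def riccati_policy_is_gain_policy by blast
  qed
  show ?thesis
    using policy solvable stabilizable by blast
qed

end
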